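(* Let $n\ge2$ and let $G\subset\mathbb{R}^n$ be a non-empty open set with non-empty boundary. Assume that $1\le p<q<np/(n-p)<\infty$ and $\beta<0$ are such that $G$ admits a $(q,p,\beta)$-Hardy--Sobolev inequality. Then, writing $\lambda=8\sqrt n$, we have either $$\overline{\dim}_A(G^c\cap B)<\frac{q}{p}(n-p+\beta)\quad\text{or}\quad \underline{\dim}_M(G^c\cap\lambda B)\ge n-p+\beta$$ whenever $B=\overline{B}(x,R)\subset\mathbb{R}^n$ is a closed ball such that $\delta_{G^c}^\beta\in L^1(\lambda B)$ and $G^c\cap\lambda B$ is porous.
   Context: $G^c=\mathbb{R}^n\setminus G$, $\delta_{E}(x)=\operatorname{dist}(x,E)$ (negative powers of $\delta_E$ equal $+\infty$ on $E$), $\overline{B}(x,R)$ is the closed ball with center $x$ and radius $R>0$, $\lambda B=\overline{B}(x,\lambda R)$, $B(x,R)$ is the open ball, $d(E)$ is the diameter of $E$, and $C_0^\infty(G)$ denotes smooth functions with compact support in $G$. The dimensions of the empty set are $0$. An open set $G$ admits a $(q,p,\beta)$-Hardy--Sobolev inequality if there is a constant $C>0$ such that $$\biggl(\int_{G} |f|^q \,\delta_{\partial G}^{(q/p)(n-p+\beta)-n}\,dx\biggr)^{1/q}\le C \biggl(\int_G |\nabla f|^p\,\delta_{\partial G}^{\beta}\,dx\biggr)^{1/p}$$ for all $f\in C_0^\infty(G)$. For bounded $A\subset\mathbb{R}^n$ and $r>0$, $N(A,r)$ is the minimal number of open balls of radius $r$ centered at points of $A$ needed to cover $A$. The (upper)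 Assouad dimension is $\overline{\dim}_A(E)=\inf\{\lambda\ge 0:\ \exists\, C_\lambda>0 \text{ such that } N(E\cap B(x,R),r)\le C_\lambda (r/R)^{-\lambda}\text{ for all } x\in E,\ 0<r<R<d(E)\}$. For bounded $E$, the lower Minkowski dimension is $\underline{\dim}_M(E)=\inf\{\lambda\ge0:\ \liminf_{r\to0}N(E,r)r^\lambda=0\}$. A set $E\subset\mathbb{R}^n$ is porous if there is a constant $0<c<1$ such that for every $x\in E$ and all $0<r<d(E)$ there is a point $y\in\mathbb{R}^n$ with $B(y,cr)\subset B(x,r)\setminus E$. *)

theory Defs
  imports "HOL-Analysis.Analysis"
begin

text \<open>The directions \<open>v\<close> are not restricted to basis vectors; by linearity of the derivative this
  is the usual class of functions whose partial derivatives up to order \<open>k\<close> are continuous.\<close>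

primrec Ck :: "nat \<Rightarrow> ('a::euclidean_space \<Rightarrow> real) \<Rightarrow> bool" where
  "Ck 0 f \<longleftrightarrow> continuous_on UNIV f"
| "Ck (Suc k) f \<longleftrightarrow> (\<forall>x. f differentiable (at x)) \<and>
     (\<forall>v. Ck k (\<lambda>x. frechet_derivative f (at x) v))"

definition smooth :: "('a::euclidean_space \<Rightarrow> real) \<Rightarrow> bool" where
  "smooth f \<longleftrightarrow> (\<forall>k. Ck k f)"

text \<open>An element of \<open>C\<^sub>0\<^sup>\<infinity>(G)\<close> is represented by its extension by zero to the whole space.\<close>

definition test_functions :: "'a::euclidean_space set \<Rightarrow> ('a \<Rightarrow> real) set" where
  "test_functions G =
     {f. smooth f \<and> compact (closure {x. f x \<noteq> 0}) \<and> closure {x. f x \<noteq> 0} \<subseteq> G}"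

definition gradient :: "('a::euclidean_space \<Rightarrow> real) \<Rightarrow> 'a \<Rightarrow> 'a" where
  "gradient f x = (THE D. GDERIV f x :> D)"

text \<open>For \<open>f \<in> test_functions G\<close> with \<open>G\<close> open and \<open>frontier G \<noteq> {}\<close>, both weights are continuous and
  positive on \<open>G\<close> and both integrands are continuous with compact support in \<open>G\<close> (as \<open>p, q > 0\<close>),
  so the Bochner integrals below never take their default value \<open>0\<close>.\<close>

definition hardy_sobolev :: "real \<Rightarrow> real \<Rightarrow> real \<Rightarrow> 'a::euclidean_space set \<Rightarrow> bool" where
  "hardy_sobolev q p \<beta> G \<longleftrightarrow> (\<exists>C>0. \<forall>f\<in>test_functions G.
     (\<integral>x\<in>G. (\<bar>f x\<bar> powr q *
        infdist x (frontier G) powr (q / p * (real DIM('a) - p + \<beta>) - real DIM('a))) \<partial>lborel) powr (1 / q)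
     \<le> C * (\<integral>x\<in>G. (norm (gradient f x) powr p * infdist x (frontier G) powr \<beta>) \<partial>lborel) powr (1 / p))"

text \<open>The library has \<open>0 powr s = 0\<close>, whereas negative powers of the distance to \<open>E\<close>
  have to be \<open>\<infinity>\<close> wherever the distance vanishes.\<close>

definition dist_power :: "'a::metric_space set \<Rightarrow> real \<Rightarrow> 'a \<Rightarrow> ennreal" where
  "dist_power E s x = (if s < 0 \<and> x \<in> closure E then \<infinity> else ennreal (infdist x E powr s))"

definition covering_number :: "'a::metric_space set \<Rightarrow> real \<Rightarrow> nat" where
  "covering_number A r =
     (LEAST k. \<exists>C. finite C \<and> C \<subseteq> A \<and> A \<subseteq> (\<Union>c\<in>C. ball c r) \<and> card C = k)"

text \<open>The library's \<open>diameter\<close> is only meaningful for bounded sets; an unbounded set has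
  infinite diameter.\<close>

definition less_diameter :: "real \<Rightarrow> 'a::metric_space set \<Rightarrow> bool" where
  "less_diameter R E \<longleftrightarrow> (bounded E \<longrightarrow> R < diameter E)"

definition upper_assouad_dim :: "'a::euclidean_space set \<Rightarrow> real" where
  "upper_assouad_dim E = Inf {l. l \<ge> 0 \<and>
     (\<exists>C>0. \<forall>x\<in>E. \<forall>r R. 0 < r \<and> r < R \<and> less_diameter R E \<longrightarrow>
        real (covering_number (E \<inter> ball x R) r) \<le> C * (r / R) powr (- l))}"

text \<open>Intended for bounded sets only.\<close>

definition lower_minkowski_dim :: "'a::euclidean_space set \<Rightarrow> real" where
  "lower_minkowski_dim E = Inf {l. l \<ge> 0 \<and>
     Liminf (at_right 0) (\<lambda>r. ereal (real (covering_number E r) * r powr l)) = 0}"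

definition porous :: "'a::metric_space set \<Rightarrow> bool" where
  "porous E \<longleftrightarrow> (\<exists>c. 0 < c \<and> c < 1 \<and>
     (\<forall>x\<in>E. \<forall>r. 0 < r \<and> less_diameter r E \<longrightarrow> (\<exists>y. ball y (c * r) \<subseteq> ball x r - E)))"

end

theory Submission
  imports Defs "HOL-Computational_Algebra.Polynomial"
begin

text \<open>Let \<open>E\<close> be the complement of \<open>G\<close> in the large ball, \<open>\<delta>\<close> the distance to the complement of \<open>G\<close>, \<open>n\<close> the dimension of
  the space, \<open>d = n - p + \<beta>\<close> and \<open>s = q / p * d\<close>. Suppose that the lower Minkowski dimension of \<open>E\<close> is below \<open>d\<close>. It has to
  be shown that the complement of \<open>G\<close> in the small ball has Assouad dimension below \<open>s\<close>.

  The smallness of \<open>E\<close> means that, along some scales tending to zero, a function can be cut off near \<open>E\<close> at a cost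
  that tends to zero in the weighted Dirichlet energy. So the Hardy--Sobolev inequality may be applied to plain bump functions
  (\<open>exists_test_function\<close>, \<open>hardy_sobolev_local\<close>), and it becomes a reverse Hoelder inequality: the integral of \<open>\<delta> powr (s - n)\<close> over
  a ball centred in the complement is controlled by a power of the integral of \<open>\<delta> powr \<beta>\<close> over the doubled ball. The bound
  \<open>q < n * p / (n - p)\<close> makes this inequality sublinear in scale-invariant terms, so that iterating it from the top
  scale, where \<open>\<delta> powr \<beta>\<close> is integrable, gives the scale-invariant bounds \<open>\<integral> \<delta> powr (s - n) \<le> K * r powr s\<close> over all balls
  of radius \<open>r\<close> (\<open>integral_growth_bootstrap\<close>).

  Such a bound is Aikawa's condition with exponent \<open>s\<close>, which by itself only gives dimension at most \<open>s\<close>. For the strict inequality,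
  porosity places disjoint balls of size comparable to \<open>\<delta>\<close> next to separated points of all scales simultaneously, so the packing
  numbers of the complement are summable over scales when weighted with the exponent \<open>s\<close> (\<open>porous_packing_sum\<close>). Packing numbers
  are submultiplicative in the scale, and for a submultiplicative sequence summability forces geometric decay, which lowers the
  exponent (\<open>packing_exponent_improvement\<close>).\<close>

section \<open>Smooth cutoff functions of one variable and their compositions\<close>

text \<open>The product of \<open>P(1/t)\<close> with the standard flat function \<open>exp(-1/t)\<close>. Carrying the polynomial
  along makes the family closed under differentiation.\<close>

definition flat :: "real poly \<Rightarrow> real \<Rightarrow> real" where
  "flat P t = (if t \<le> 0 then 0 else poly P (1 / t) * exp (- (1 / t)))"

lemma tendsto_power_poly_exp:
  "((\<lambda>x::real. x ^ k * poly P x * exp (- x)) \<longlongrightarrow> 0) at_top"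
proof (induction P arbitrary: k)
  case 0
  then show ?case by simp
next
  case (pCons a P)
  have "((\<lambda>x::real. a * (x ^ k / exp x) + x ^ Suc k * poly P x * exp (- x)) \<longlongrightarrow> a * 0 + 0) at_top"
    by (intro tendsto_intros tendsto_power_div_exp_0 pCons.IH)
  then show ?case
    by (simp add: algebra_simps exp_minus divide_inverse)
qed

lemma flat_tendsto_0: "(flat P \<longlongrightarrow> 0) (at 0)"
proof -
  have *: "((\<lambda>t. poly P (1 / t) * exp (- (1 / t))) \<longlongrightarrow> 0) (at_right 0)"
    using filterlim_compose[OF tendsto_power_poly_exp[of 0 P] filterlim_inverse_at_top_right]
    by (simp add: inverse_eq_divide)
  have "(flat P \<longlongrightarrow> 0) (at_right 0)"
    by (rule Lim_transform_eventually[OF *])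
       (auto simp: flat_def eventually_at_right_less intro!: eventually_at_rightI[of 0 1])
  moreover have "(flat P \<longlongrightarrow> 0) (at_left 0)"
    by (rule Lim_transform_eventually[OF tendsto_const])
       (auto simp: flat_def intro!: eventually_at_leftI[of "-1" 0])
  ultimately show ?thesis
    by (simp add: filterlim_split_at)
qed

lemma flat_has_derivative:
  "(flat P has_real_derivative flat ([:0, 0, 1:] * (P - pderiv P)) t) (at t)"
proof -
  let ?Q = "[:0, 0, 1:] * (P - pderiv P)"
  consider "t < 0" | "t = 0" | "t > 0" by linarith
  then show ?thesis
  proof cases
    case 1
    have "(flat P has_real_derivative 0) (at t)"
      by (rule has_field_derivative_transform_within_open[where f="\<lambda>_. 0" and S="{..<0}"])
         (use 1 in \<open>auto simp: flat_def\<close>)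
    with 1 show ?thesis by (simp add: flat_def)
  next
    case 2
    have "((\<lambda>h. flat P h / h) \<longlongrightarrow> 0) (at 0)"
      by (rule Lim_transform_eventually[OF flat_tendsto_0[of "pCons 0 P"]])
         (auto simp: flat_def eventually_at_filter)
    with 2 show ?thesis by (simp add: has_field_derivative_iff flat_def)
  next
    case 3
    have "((\<lambda>t. poly P (1 / t) * exp (- (1 / t))) has_real_derivative flat ?Q t) (at t)"
      using 3 by (auto intro!: derivative_eq_intros DERIV_chain2[OF poly_DERIV]
            simp: flat_def field_simps power2_eq_square)
    then show ?thesis
      by (rule has_field_derivative_transform_within_open[where S="{0<..}"])
         (use 3 in \<open>auto simp: flat_def\<close>)
  qed
qed

text \<open>Every derivative of one of these functions is again one of them, so the iterated differentiability
  required by \<^const>\<open>smooth\<close> is a plain induction on the order, and no product or chain rule for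
  \<^const>\<open>Ck\<close> itself has to be established.\<close>

inductive smooth_term :: "('a::euclidean_space \<Rightarrow> real) \<Rightarrow> bool" where
  const: "smooth_term (\<lambda>x. a)"
| inner: "smooth_term (\<lambda>x. x \<bullet> v)"
| inner_self: "smooth_term (\<lambda>x. x \<bullet> x)"
| add: "smooth_term f \<Longrightarrow> smooth_term g \<Longrightarrow> smooth_term (\<lambda>x. f x + g x)"
| mult: "smooth_term f \<Longrightarrow> smooth_term g \<Longrightarrow> smooth_term (\<lambda>x. f x * g x)"
| inverse: "smooth_term f \<Longrightarrow> (\<And>x. f x \<noteq> 0) \<Longrightarrow> smooth_term (\<lambda>x. inverse (f x))"
| flat: "smooth_term f \<Longrightarrow> smooth_term (\<lambda>x. flat P (f x))"

lemma smooth_term_derivative: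
  "smooth_term f \<Longrightarrow>
    \<exists>f'. (\<forall>x. (f has_derivative f' x) (at x)) \<and> (\<forall>v. smooth_term (\<lambda>x. f' x v))"
proof (induction rule: smooth_term.induct)
  case (const a)
  show ?case
    by (intro exI[of _ "\<lambda>x v. 0"]) (auto intro: smooth_term.const)
next
  case (inner v)
  show ?case
    by (intro exI[of _ "\<lambda>x h. h \<bullet> v"])
       (auto intro: smooth_term.const intro!: derivative_eq_intros)
next
  case inner_self
  have "((\<lambda>x. x \<bullet> x) has_derivative (\<lambda>h. x \<bullet> h + x \<bullet> h)) (at x)" for x :: 'a
    by (auto intro!: derivative_eq_intros simp: inner_commute[of _ x])
  then show ?case
    by (intro exI[of _ "\<lambda>x h. x \<bullet> h + x \<bullet> h"])
       (intro conjI allI smooth_term.add smooth_term.inner, assumption)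
next
  case (add f g)
  then obtain f' g' where "\<And>x. (f has_derivative f' x) (at x)" "\<And>v. smooth_term (\<lambda>x. f' x v)"
    "\<And>x. (g has_derivative g' x) (at x)" "\<And>v. smooth_term (\<lambda>x. g' x v)" by metis
  then show ?case
    by (intro exI[of _ "\<lambda>x h. f' x h + g' x h"])
       (auto intro!: smooth_term.add derivative_intros)
next
  case (mult f g)
  then obtain f' g' where "\<And>x. (f has_derivative f' x) (at x)" "\<And>v. smooth_term (\<lambda>x. f' x v)"
    "\<And>x. (g has_derivative g' x) (at x)" "\<And>v. smooth_term (\<lambda>x. g' x v)" by metis
  then show ?case using mult.hyps
    by (intro exI[of _ "\<lambda>x h. f x * g' x h + f' x h * g x"])
       (auto intro!: smooth_term.add smooth_term.mult derivative_intros)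
next
  case (inverse f)
  then obtain f' where "\<And>x. (f has_derivative f' x) (at x)" "\<And>v. smooth_term (\<lambda>x. f' x v)"
    by metis
  moreover from this inverse.hyps
  have "((\<lambda>x. inverse (f x)) has_derivative (\<lambda>h. (-1) * (inverse (f x) * f' x h * inverse (f x)))) (at x)" for x
    by (auto intro!: derivative_eq_intros)
  ultimately show ?case using inverse.hyps
    by (intro exI[of _ "\<lambda>x h. (-1) * (inverse (f x) * f' x h * inverse (f x))"] conjI allI
              smooth_term.mult smooth_term.const smooth_term.inverse) 
next
  case (flat f P)
  then obtain f' where f': "\<And>x. (f has_derivative f' x) (at x)" "\<And>v. smooth_term (\<lambda>x. f' x v)"
    by metis
  let ?Q = "[:0, 0, 1:] * (P - pderiv P)"
  have "((\<lambda>x. flat P (f x)) has_derivative (\<lambda>h. flat ?Q (f x) * f' x h)) (at x)" for x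
    using DERIV_compose_FDERIV[OF flat_has_derivative f'(1)] by (simp add: mult.commute)
  with f'(2) flat.hyps show ?case
    by (intro exI[of _ "\<lambda>x h. flat ?Q (f x) * f' x h"])
       (auto intro: smooth_term.mult smooth_term.flat)
qed

lemma smooth_term_imp_smooth:
  assumes "smooth_term f"
  shows "smooth f"
proof -
  have "Ck k f" for k
    using assms
  proof (induction k arbitrary: f)
    case 0
    then obtain f' where "\<And>x. (f has_derivative f' x) (at x)"
      using smooth_term_derivative by blast
    then show ?case
      by (auto intro!: has_derivative_continuous_on)
  next
    case (Suc k)
    then obtain f' where f': "\<And>x. (f has_derivative f' x) (at x)" "\<And>v. smooth_term (\<lambda>x. f' x v)"
      using smooth_term_derivative by blast
    then have "frechet_derivative f (at x) = f' x" for x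
      using frechet_derivative_at by metis
    with f' Suc.IH show ?case
      by (auto simp: differentiable_def)
  qed
  then show ?thesis by (simp add: smooth_def)
qed

lemma smooth_term_diff:
  assumes "smooth_term f" "smooth_term g" shows "smooth_term (\<lambda>x. f x - g x)"
  using smooth_term.add[OF assms(1) smooth_term.mult[OF smooth_term.const[of "-1"] assms(2)]]
  by simp

lemma smooth_term_prod:
  assumes "finite I" "\<And>i. i \<in> I \<Longrightarrow> smooth_term (f i)"
  shows "smooth_term (\<lambda>x. \<Prod>i\<in>I. f i x)"
  using assms by (induction I) (auto intro: smooth_term.const smooth_term.mult)

text \<open>The usual smooth transition from \<open>0\<close> on \<open>(-\<infinity>, 1]\<close> to \<open>1\<close> on \<open>[2, \<infinity>)\<close>.\<close>

definition smooth_step :: "real \<Rightarrow> real" where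
  "smooth_step t = flat 1 (t - 1) * inverse (flat 1 (t - 1) + flat 1 (2 - t))"

lemma flat_one_pos_iff: "flat 1 t > 0 \<longleftrightarrow> t > 0"
  and flat_one_nonneg: "flat 1 t \<ge> 0"
  by (auto simp: flat_def)

lemma smooth_step_denominator: "flat 1 (t - 1) + flat 1 (2 - t) > 0"
  using flat_one_pos_iff[of "t - 1"] flat_one_pos_iff[of "2 - t"]
    flat_one_nonneg[of "t - 1"] flat_one_nonneg[of "2 - t"]
  by (cases "t > 1") (auto intro: add_pos_nonneg add_nonneg_pos)

lemma smooth_step_bounds: "0 \<le> smooth_step t" "smooth_step t \<le> 1"
  using smooth_step_denominator[of t] flat_one_nonneg[of "t - 1"] flat_one_nonneg[of "2 - t"]
  by (auto simp: smooth_step_def field_simps)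

lemma smooth_step_eq_0: "t \<le> 1 \<Longrightarrow> smooth_step t = 0"
  by (simp add: smooth_step_def flat_def)

lemma smooth_step_eq_1: "t \<ge> 2 \<Longrightarrow> smooth_step t = 1"
  using smooth_step_denominator[of t] by (simp add: smooth_step_def) (simp add: flat_def)

lemma smooth_term_step:
  assumes "smooth_term f" shows "smooth_term (\<lambda>x. smooth_step (f x))"
proof -
  have "smooth_term (\<lambda>x. flat 1 (f x - 1))" "smooth_term (\<lambda>x. flat 1 (2 - f x))"
    using assms by (auto intro!: smooth_term.flat smooth_term_diff smooth_term.const)
  then show ?thesis
    unfolding smooth_step_def
    by (intro smooth_term.mult smooth_term.inverse smooth_term.add)
       (simp_all add: less_imp_neq[OF smooth_step_denominator, symmetric])
qed

text \<open>The derivative is continuous, hence bounded on the transition interval, and it vanishes off that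
  interval because the function is locally constant there.\<close>

lemma smooth_step_derivative:
  obtains H' M where "M > 0" "\<And>t. (smooth_step has_real_derivative H' t) (at t)"
    "\<And>t. \<bar>H' t\<bar> \<le> M" "\<And>t. t < 1 \<Longrightarrow> H' t = 0" "\<And>t. t > 2 \<Longrightarrow> H' t = 0"
proof -
  have "smooth_term (\<lambda>x::real. x)"
    using smooth_term.inner[of "1::real"] by simp
  from smooth_term_step[OF this] have "smooth_term smooth_step" by simp
  from smooth_term_derivative[OF this] obtain f' where f':
    "\<And>x. (smooth_step has_derivative f' x) (at x)" "\<And>v. smooth_term (\<lambda>x. f' x v)" by blast
  define H' where "H' = (\<lambda>x. f' x 1)"
  have der: "(smooth_step has_real_derivative H' t) (at t)" for t
  proof -
    have "bounded_linear (f' t)" using f'(1) by (rule has_derivative_bounded_linear)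
    then have "f' t x = H' t * x" for x
      using linear_simps(5)[of "f' t" x 1] by (simp add: H'_def)
    then show ?thesis using f'(1)[of t] 
      by (simp add: has_field_derivative_def) (metis (no_types, lifting) ext)
  qed
  have lo: "H' t = 0" if "t < 1" for t
  proof (rule DERIV_unique[OF der])
    show "(smooth_step has_real_derivative 0) (at t)"
      by (rule has_field_derivative_transform_within_open[where f="\<lambda>_. 0" and S="{..<1}"])
         (use that in \<open>auto simp: smooth_step_eq_0\<close>)
  qed
  have hi: "H' t = 0" if "t > 2" for t
  proof (rule DERIV_unique[OF der])
    show "(smooth_step has_real_derivative 0) (at t)"
      by (rule has_field_derivative_transform_within_open[where f="\<lambda>_. 1" and S="{2<..}"])
         (use that in \<open>auto simp: smooth_step_eq_1\<close>)
  qed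
  have "smooth H'" unfolding H'_def by (rule smooth_term_imp_smooth[OF f'(2)])
  then have "continuous_on UNIV H'" unfolding smooth_def using Ck.simps(1) by blast
  then have "compact (H' ` {1..2})"
    by (intro compact_continuous_image) (auto intro: continuous_on_subset)
  then obtain M where M: "M > 0" "\<And>t. t \<in> {1..2} \<Longrightarrow> \<bar>H' t\<bar> \<le> M"
    by (metis bounded_pos compact_imp_bounded imageI real_norm_def)
  have "\<bar>H' t\<bar> \<le> M" for t
    using M lo[of t] hi[of t] by (cases "t < 1"; cases "t > 2") auto
  with M der lo hi that show ?thesis by blast
qed

section \<open>Separated sets and covering numbers\<close>

definition separated :: "real \<Rightarrow> 'a::metric_space set \<Rightarrow> bool" where
  "separated r X \<longleftrightarrow> (\<forall>x\<in>X. \<forall>y\<in>X. x \<noteq> y \<longrightarrow> r \<le> dist x y)"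

lemma separated_subset: "separated r X \<Longrightarrow> Y \<subseteq> X \<Longrightarrow> separated r Y"
  by (auto simp: separated_def)

lemma separated_mono: "separated r X \<Longrightarrow> s \<le> r \<Longrightarrow> separated s X"
  by (force simp: separated_def)

text \<open>The balls of radius \<open>\<rho>\<close> around the points of \<open>X\<close> are disjoint and lie in one ball of radius
  \<open>S + \<rho>\<close>; compare volumes.\<close>

lemma card_separated_le:
  fixes X :: "'a::euclidean_space set"
  assumes "finite X" "separated (2 * \<rho>) X" "\<rho> > 0" "S \<ge> 0" "X \<subseteq> cball y S"
  shows "real (card X) * \<rho> ^ DIM('a) \<le> (S + \<rho>) ^ DIM('a)"
proof -
  have disj: "disjoint_family_on (\<lambda>x. ball x \<rho>) X"
    unfolding disjoint_family_on_def
  proof (intro ballI impI equals0I)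
    fix a b z assume "a \<in> X" "b \<in> X" "a \<noteq> b" "z \<in> ball a \<rho> \<inter> ball b \<rho>"
    moreover from this have "2 * \<rho> \<le> dist a b" using assms(2) by (auto simp: separated_def)
    ultimately show False using dist_triangle2[of a b z] by (simp add: dist_commute)
  qed
  have "real (card X) * (unit_ball_vol DIM('a) * \<rho> ^ DIM('a)) = (\<Sum>x\<in>X. measure lborel (ball x \<rho>))"
    using assms by (simp add: content_ball)
  also have "\<dots> = measure lborel (\<Union>x\<in>X. ball x \<rho>)"
    using disj assms(1) emeasure_lborel_ball_finite[THEN less_imp_neq]
    by (intro measure_finite_Union[symmetric]) auto
  also have "\<dots> \<le> measure lborel (ball y (S + \<rho>))"
  proof (rule measure_mono_fmeasurable)
    show "(\<Union>x\<in>X. ball x \<rho>) \<subseteq> ball y (S + \<rho>)"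
    proof (intro UN_least subsetI)
      fix x z assume "x \<in> X" "z \<in> ball x \<rho>"
      with assms(5) dist_triangle[of y z x] show "z \<in> ball y (S + \<rho>)" by auto
    qed
  next
    show "ball y (S + \<rho>) \<in> fmeasurable lborel"
      using emeasure_lborel_ball_finite[of y "S + \<rho>"] by (intro fmeasurableI) simp_all
    show "(\<Union>x\<in>X. ball x \<rho>) \<in> sets lborel"
      by (auto intro!: borel_open)
  qed
  also have "\<dots> = unit_ball_vol DIM('a) * (S + \<rho>) ^ DIM('a)"
    using assms by (simp add: content_ball)
  finally show ?thesis
    using unit_ball_vol_pos[of "real DIM('a)"] by (simp add: mult.left_commute)
qed

text \<open>The volume bound limits the cardinality of separated subsets, so one of maximal cardinality
  exists, and by maximality its points form a net.\<close>

lemma exists_maximal_separated: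
  fixes A :: "'a::euclidean_space set"
  assumes "bounded A" "r > 0"
  obtains X where "finite X" "X \<subseteq> A" "separated r X" "A \<subseteq> (\<Union>x\<in>X. ball x r)"
proof -
  obtain y S where "A \<subseteq> cball y S" using assms(1) unfolding bounded_subset_cball by blast
  then have S: "A \<subseteq> cball y (max S 0)" by auto
  define b where "b = (max S 0 + r / 2) ^ DIM('a) / (r / 2) ^ DIM('a)"
  let ?P = "\<lambda>X. finite X \<and> X \<subseteq> A \<and> separated r X"
  have "\<forall>X. ?P X \<longrightarrow> card X < Suc (nat \<lceil>b\<rceil>)"
  proof (intro allI impI)
    fix X assume X: "?P X"
    with S card_separated_le[of X "r / 2" "max S 0" y] assms(2)
    have "real (card X) \<le> b" by (auto simp: b_def field_simps)
    then have "real (card X) \<le> real_of_int \<lceil>b\<rceil>" by linarith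
    then show "card X < Suc (nat \<lceil>b\<rceil>)" by linarith
  qed
  moreover have "?P {}" by (simp add: separated_def)
  ultimately obtain X where X: "?P X" and mx: "\<And>Y. ?P Y \<Longrightarrow> card Y \<le> card X"
    using ex_has_greatest_nat[of ?P "{}" card "Suc (nat \<lceil>b\<rceil>)"] by (metis less_imp_le)
  have "A \<subseteq> (\<Union>x\<in>X. ball x r)"
  proof (rule ccontr)
    assume "\<not> ?thesis"
    then obtain a where a: "a \<in> A" "\<And>x. x \<in> X \<Longrightarrow> r \<le> dist x a" by force
    then have "a \<notin> X" using assms(2) by force
    moreover have "?P (insert a X)"
      using X a by (auto simp: separated_def dist_commute)
    ultimately show False using mx[of "insert a X"] X by simp
  qed
  with X that show ?thesis by blast
qed

lemma covering_number_le:
  assumes "finite C" "C \<subseteq> A" "A \<subseteq> (\<Union>c\<in>C. ball c r)"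
  shows "covering_number A r \<le> card C"
  unfolding covering_number_def by (rule Least_le) (use assms in blast)

text \<open>A ball of radius \<open>r\<close> contains at most one point of a set that is \<open>2 * r\<close>-separated.\<close>

lemma card_separated_le_covering_number:
  fixes A :: "'a::euclidean_space set"
  assumes "bounded A" "r > 0" "X \<subseteq> A" "separated (2 * r) X"
  shows "finite X" "card X \<le> covering_number A r"
proof -
  obtain X0 where "finite X0" "X0 \<subseteq> A" "A \<subseteq> (\<Union>c\<in>X0. ball c r)"
    using exists_maximal_separated[OF assms(1,2)] by metis
  then have "\<exists>k. \<exists>C. finite C \<and> C \<subseteq> A \<and> A \<subseteq> (\<Union>c\<in>C. ball c r) \<and> card C = k" by blast
  from LeastI_ex[OF this] obtain C where C: "finite C" "A \<subseteq> (\<Union>c\<in>C. ball c r)"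
    "card C = covering_number A r" unfolding covering_number_def by blast
  with assms(3) have "\<forall>x\<in>X. \<exists>c\<in>C. dist c x < r" by (auto simp: subset_iff)
  then obtain g where g: "\<And>x. x \<in> X \<Longrightarrow> g x \<in> C \<and> dist (g x) x < r" by metis
  have "inj_on g X"
  proof (rule inj_onI, rule ccontr)
    fix x y assume "x \<in> X" "y \<in> X" "g x = g y" "x \<noteq> y"
    moreover from this have "2 * r \<le> dist x y" using assms(4) by (simp add: separated_def)
    ultimately show False
      using g[of x] g[of y] dist_triangle3[of x y "g x"] by simp
  qed
  moreover have "g ` X \<subseteq> C" using g by auto
  ultimately show "finite X" "card X \<le> covering_number A r"
    using C card_inj_on_le inj_on_finite by metis+
qed

lemma le_infdistI:
  assumes "A \<noteq> {}" "\<And>a. a \<in> A \<Longrightarrow> r \<le> dist x a"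
  shows "r \<le> infdist x A"
  using assms by (simp add: infdist_notempty cINF_greatest)

text \<open>Every exponent above the ambient dimension is admissible in the definition of
  \<^const>\<open>lower_minkowski_dim\<close>, so the infimum there is over a non-empty set, and an infimum below \<open>d\<close> yields an
  admissible exponent below \<open>d\<close>.\<close>

lemma exists_minkowski_exponent:
  fixes E :: "'a::euclidean_space set"
  assumes "bounded E" "lower_minkowski_dim E < d"
  obtains l where "0 \<le> l" "l < d"
    "\<And>\<epsilon>. \<epsilon> > 0 \<Longrightarrow> \<exists>r. 0 < r \<and> r < \<epsilon> \<and> real (covering_number E r) * r powr l < \<epsilon>"
proof -
  let ?S = "{l. l \<ge> 0 \<and>
     Liminf (at_right 0) (\<lambda>r. ereal (real (covering_number E r) * r powr l)) = 0}"
  let ?n = "DIM('a)"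
  obtain y S where "E \<subseteq> cball y S" using assms(1) unfolding bounded_subset_cball by blast
  then have S: "E \<subseteq> cball y (max S 0)" by auto
  define T where "T = max S 0"
  have T: "E \<subseteq> cball y T" "T \<ge> 0" using S by (auto simp: T_def)
  have "((\<lambda>r. (2 * T + r) ^ ?n * r) \<longlongrightarrow> (2 * T + 0) ^ ?n * 0) (at_right 0)"
    by (intro tendsto_intros)
  then have lim0: "((\<lambda>r. (2 * T + r) ^ ?n * r) \<longlongrightarrow> 0) (at_right 0)" by simp
  have "((\<lambda>r. real (covering_number E r) * r powr (?n + 1)) \<longlongrightarrow> 0) (at_right 0)"
  proof (rule tendsto_sandwich[OF _ _ tendsto_const lim0])
    show "\<forall>\<^sub>F r in at_right 0. real (covering_number E r) * r powr (?n + 1) \<le> (2 * T + r) ^ ?n * r"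
    proof (rule eventually_at_rightI[of 0 1])
      fix r :: real assume r: "r \<in> {0<..<1}"
      then obtain X where X: "finite X" "X \<subseteq> E" "separated r X" "E \<subseteq> (\<Union>x\<in>X. ball x r)"
        using exists_maximal_separated[OF assms(1), of r] by auto
      have "real (covering_number E r) * (r / 2) ^ ?n \<le> card X * (r / 2) ^ ?n"
        using covering_number_le[OF X(1,2,4)] r by (intro mult_right_mono) auto
      also have "\<dots> \<le> (T + r / 2) ^ ?n"
        using card_separated_le[of X "r / 2" T y] X T r by auto
      also have "\<dots> = (2 * T + r) ^ ?n / 2 ^ ?n"
        by (simp add: power_divide[symmetric] add_divide_distrib)
      finally have "real (covering_number E r) * r ^ ?n \<le> (2 * T + r) ^ ?n"
        by (simp add: power_divide field_simps)
      then have "real (covering_number E r) * r ^ ?n * r \<le> (2 * T + r) ^ ?n * r"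
        using r by (intro mult_right_mono) auto
      then show "real (covering_number E r) * r powr (?n + 1) \<le> (2 * T + r) ^ ?n * r"
        using r by (simp add: powr_add powr_realpow mult.assoc)
    qed simp
  qed (auto intro: always_eventually)
  then have "((\<lambda>r. ereal (real (covering_number E r) * r powr (?n + 1))) \<longlongrightarrow> ereal 0) (at_right 0)"
    by (rule tendsto_ereal)
  then have "Liminf (at_right 0) (\<lambda>r. ereal (real (covering_number E r) * r powr (?n + 1))) = ereal 0"
    by (rule lim_imp_Liminf[OF trivial_limit_at_right_real])
  then have "real (?n + 1) \<in> ?S" by (simp add: zero_ereal_def)
  then have "?S \<noteq> {}" by blast
  from cInf_lessD[OF this] assms(2) obtain l where l: "l \<ge> 0" "l < d"
    "Liminf (at_right 0) (\<lambda>r. ereal (real (covering_number E r) * r powr l)) = 0"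
    unfolding lower_minkowski_dim_def by blast
  have "\<exists>r. 0 < r \<and> r < \<epsilon> \<and> real (covering_number E r) * r powr l < \<epsilon>" if "\<epsilon> > 0" for \<epsilon>
  proof (rule ccontr)
    assume "\<not> ?thesis"
    then have "\<forall>\<^sub>F r in at_right 0. ereal \<epsilon> \<le> ereal (real (covering_number E r) * r powr l)"
      using that by (intro eventually_at_rightI[of 0 \<epsilon>]) (simp_all add: not_less, meson not_less)
    from Liminf_bounded[OF this] l(3) that show False by simp
  qed
  with l that show ?thesis by blast
qed

section \<open>Cutting off near the complement of an open set\<close>

text \<open>The Riesz representative of the derivative is the value of the definite description.\<close>

lemma gradient_inner:
  fixes f :: "'a::euclidean_space \<Rightarrow> real"
  assumes "(f has_derivative f') (at x)"
  shows "f' h = h \<bullet> gradient f x"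
proof -
  define D where "D = (\<Sum>b\<in>Basis. f' b *\<^sub>R b)"
  interpret bounded_linear f' using assms by (rule has_derivative_bounded_linear)
  have f'_eq: "f' h = h \<bullet> D" for h
  proof -
    have "f' h = f' (\<Sum>b\<in>Basis. (h \<bullet> b) *\<^sub>R b)" by (simp add: euclidean_representation)
    then show ?thesis by (simp add: D_def sum scaleR inner_sum_right mult.commute)
  qed
  have "f' = (\<lambda>h. h \<bullet> D)" using f'_eq by blast
  with assms have "(f has_derivative (\<lambda>h. h \<bullet> D)) (at x)" by simp
  then have "GDERIV f x :> D" by (simp add: gderiv_def)
  moreover have "D' = D" if "GDERIV f x :> D'" for D'
  proof -
    have "(\<lambda>h. h \<bullet> D') = f'"
      using that assms unfolding gderiv_def by (rule has_derivative_unique)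
    then have "h \<bullet> D' = h \<bullet> D" for h using f'_eq by metis
    then show ?thesis by (metis inner_commute vector_eq_rdot)
  qed
  ultimately have "gradient f x = D" unfolding gradient_def by (rule the_equality)
  with f'_eq show ?thesis by simp
qed

lemma norm_gradient_le:
  fixes f :: "'a::euclidean_space \<Rightarrow> real"
  assumes "(f has_derivative f') (at x)" "\<And>h. \<bar>f' h\<bar> \<le> B * norm h"
  shows "norm (gradient f x) \<le> B"
proof (cases "gradient f x = 0")
  case True
  obtain b :: 'a where "b \<in> Basis" using nonempty_Basis by blast
  then show ?thesis using assms(2)[of b] True by simp
next
  case False
  have "norm (gradient f x) * norm (gradient f x) \<le> B * norm (gradient f x)"
    using assms(2)[of "gradient f x"] gradient_inner[OF assms(1), of "gradient f x"]
    by (simp add: norm_eq_sqrt_inner flip: power2_eq_square)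
  with False show ?thesis by simp
qed

text \<open>It vanishes on the ball of radius \<open>\<rho>\<close> about \<open>c\<close> and equals \<open>1\<close> outside the ball of radius
  \<open>sqrt 2 * \<rho>\<close>. The squared distance keeps it smooth at \<open>c\<close>.\<close>

definition cutoff :: "'a::euclidean_space \<Rightarrow> real \<Rightarrow> 'a \<Rightarrow> real" where
  "cutoff c \<rho> y = smooth_step ((y - c) \<bullet> (y - c) * inverse (\<rho>\<^sup>2))"

lemma smooth_term_cutoff: "smooth_term (cutoff c \<rho>)"
proof -
  have "smooth_term (\<lambda>y. (y \<bullet> y + (y \<bullet> (-2 *\<^sub>R c) + c \<bullet> c)) * inverse (\<rho>\<^sup>2))"
    by (intro smooth_term.intros)
  moreover have "(y - c) \<bullet> (y - c) = y \<bullet> y + (y \<bullet> (-2 *\<^sub>R c) + c \<bullet> c)" for y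
    by (simp add: inner_simps inner_commute)
  ultimately have "smooth_term (\<lambda>y. (y - c) \<bullet> (y - c) * inverse (\<rho>\<^sup>2))" by simp
  from smooth_term_step[OF this] show ?thesis unfolding cutoff_def .
qed

lemma cutoff_bounds: "0 \<le> cutoff c \<rho> y" "cutoff c \<rho> y \<le> 1"
  by (simp_all add: cutoff_def smooth_step_bounds)

lemma cutoff_arg: "(y - c) \<bullet> (y - c) * inverse (\<rho>\<^sup>2) = (dist y c / \<rho>)\<^sup>2"
  by (simp add: dist_norm power_mult_distrib power_inverse power2_norm_eq_inner divide_inverse)

lemma cutoff_eq_0: "dist y c \<le> \<rho> \<Longrightarrow> 0 < \<rho> \<Longrightarrow> cutoff c \<rho> y = 0"
  unfolding cutoff_def cutoff_arg by (rule smooth_step_eq_0) (simp add: power_le_one)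

lemma cutoff_eq_1:
  assumes "3 / 2 * \<rho> \<le> dist y c" "0 < \<rho>" shows "cutoff c \<rho> y = 1"
  unfolding cutoff_def cutoff_arg
proof (rule smooth_step_eq_1)
  have "2 \<le> (3 / 2 :: real)\<^sup>2" by (simp add: power2_eq_square)
  also have "\<dots> \<le> (dist y c / \<rho>)\<^sup>2"
    using assms by (intro power_mono) (auto simp: field_simps)
  finally show "2 \<le> (dist y c / \<rho>)\<^sup>2" .
qed

lemma cutoff_derivative:
  obtains M where "M > 0" and
    "\<And>(c::'a::euclidean_space) \<rho> y. \<rho> > 0 \<Longrightarrow> \<exists>f'. (cutoff c \<rho> has_derivative f') (at y) \<and>
      (\<forall>h. \<bar>f' h\<bar> \<le> M / \<rho> * norm h) \<and>
      (dist y c < \<rho> \<or> 3 / 2 * \<rho> \<le> dist y c \<longrightarrow> (\<forall>h. f' h = 0))"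
proof -
  obtain H' M where M: "M > 0" and H': "\<And>t. (smooth_step has_real_derivative H' t) (at t)"
    "\<And>t. \<bar>H' t\<bar> \<le> M" "\<And>t. t < 1 \<Longrightarrow> H' t = 0" "\<And>t. t > 2 \<Longrightarrow> H' t = 0"
    using smooth_step_derivative by metis
  have "\<exists>f'. (cutoff c \<rho> has_derivative f') (at y) \<and>
      (\<forall>h. \<bar>f' h\<bar> \<le> (3 * M) / \<rho> * norm h) \<and>
      (dist y c < \<rho> \<or> 3 / 2 * \<rho> \<le> dist y c \<longrightarrow> (\<forall>h. f' h = 0))"
    if \<rho>: "\<rho> > 0" for c :: 'a and \<rho> y
  proof -
    define t where "t = (y - c) \<bullet> (y - c) * inverse (\<rho>\<^sup>2)"
    have t: "t = (dist y c / \<rho>)\<^sup>2" by (simp add: t_def cutoff_arg)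
    define f' where "f' = (\<lambda>h. H' t * (2 * ((y - c) \<bullet> h) * inverse (\<rho>\<^sup>2)))"
    have "((\<lambda>y. (y - c) \<bullet> (y - c) * inverse (\<rho>\<^sup>2)) has_derivative
        (\<lambda>h. 2 * ((y - c) \<bullet> h) * inverse (\<rho>\<^sup>2))) (at y)"
      by (auto intro!: derivative_eq_intros simp: inner_commute[of _ "y - c"])
    from DERIV_compose_FDERIV[OF H'(1) this]
    have der: "(cutoff c \<rho> has_derivative f') (at y)"
      unfolding cutoff_def f'_def t_def by (simp add: mult.commute cutoff_def[abs_def])
    have far: "f' h = 0" if "3 / 2 * \<rho> \<le> dist y c" for h
    proof -
      have "2 < (3 / 2 :: real)\<^sup>2" by (simp add: power2_eq_square)
      also have "\<dots> \<le> (dist y c / \<rho>)\<^sup>2"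
        using that \<rho> by (intro power_mono) (auto simp: field_simps)
      finally show ?thesis using H'(4)[of t] by (simp add: f'_def t)
    qed
    have near: "f' h = 0" if "dist y c < \<rho>" for h
    proof -
      have "(dist y c / \<rho>)\<^sup>2 < 1\<^sup>2"
        using that \<rho> by (intro power_strict_mono) auto
      then show ?thesis using H'(3)[of t] by (simp add: f'_def t)
    qed
    have "\<bar>f' h\<bar> \<le> (3 * M) / \<rho> * norm h" for h
    proof (cases "3 / 2 * \<rho> \<le> dist y c")
      case True
      then show ?thesis using far M \<rho> by simp
    next
      case False
      have "\<bar>f' h\<bar> = \<bar>H' t\<bar> * (2 * \<bar>(y - c) \<bullet> h\<bar> * inverse (\<rho>\<^sup>2))"
        by (simp add: f'_def abs_mult)
      also have "\<dots> \<le> M * (2 * (dist y c * norm h) * inverse (\<rho>\<^sup>2))"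
        using H'(2)[of t] Cauchy_Schwarz_ineq2[of "y - c" h] M
        by (intro mult_mono mult_nonneg_nonneg) (auto simp: dist_norm)
      also have "\<dots> \<le> M * (2 * (3 / 2 * \<rho> * norm h) * inverse (\<rho>\<^sup>2))"
        using M \<rho> False by (intro mult_left_mono mult_right_mono) auto
      also have "\<dots> = (3 * M) / \<rho> * norm h"
        using \<rho> by (simp add: field_simps power2_eq_square)
      finally show ?thesis .
    qed
    with der near far show ?thesis by blast
  qed
  with M that[of "3 * M"] show ?thesis by simp
qed

text \<open>The segment from \<open>y\<close> to a nearest point of the complement meets the frontier.\<close>

lemma infdist_frontier_eq:
  fixes G :: "'a::euclidean_space set"
  assumes "open G" "frontier G \<noteq> {}" "y \<in> G"
  shows "infdist y (frontier G) = infdist y (- G)"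
proof (rule antisym)
  have sub: "frontier G \<subseteq> - G"
    using assms(1) by (auto simp: frontier_def interior_open)
  then show "infdist y (- G) \<le> infdist y (frontier G)"
    using assms(2) by (rule infdist_mono)
  have "- G \<noteq> {}" "closed (- G)" using sub assms(1,2) by auto
  then obtain g where g: "g \<in> - G" "infdist y (- G) = dist y g"
    using infdist_attains_inf by metis
  have "closed_segment y g \<inter> frontier G \<noteq> {}"
    using g assms(3) by (intro connected_Int_frontier) auto
  then obtain u where u: "u \<in> closed_segment y g" "u \<in> frontier G" by blast
  have "infdist y (frontier G) \<le> dist y u" using u(2) by (rule infdist_le)
  also have "\<dots> \<le> dist y g" using dist_in_closed_segment[OF u(1)] by (simp add: dist_commute)
  finally show "infdist y (frontier G) \<le> infdist y (- G)" using g by simp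
qed

text \<open>The test functions behind the whole argument: a bump adapted to \<open>ball z r\<close>, multiplied by cutoffs
  that remove a neighbourhood of every point of a \<open>2 * \<rho>\<close>-net \<open>X\<close> of the complement, so that the support stays
  inside \<open>G\<close>. The gradient has a part of size \<open>1 / r\<close> from the bump and a part of size \<open>1 / \<rho>\<close> from the
  net. The latter does not degenerate when \<open>X\<close> grows, since the points of a separated set within distance
  \<open>5 * \<rho>\<close> of a given point are at most \<open>6 ^ DIM('a)\<close> many; and it lives where the distance to
  the complement is at least \<open>\<rho>\<close>, which is what controls a weight with negative exponent. The constant \<open>M\<close> depends on the
  space only, hence the order of the quantifiers.\<close>

lemma exists_test_function:
  "\<exists>M>0. \<forall>(G::'a::euclidean_space set) X \<rho> r x0 z T.
      open G \<and> G \<noteq> UNIV \<and> finite X \<and> X \<subseteq> - G \<and> separated (2 * \<rho>) X \<and>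
      - G \<inter> cball x0 T \<subseteq> (\<Union>c\<in>X. ball c (2 * \<rho>)) \<and> \<rho> > 0 \<and> r > 0 \<and>
      dist x0 z + 2 * r + \<rho> \<le> T \<longrightarrow>
      (\<exists>f \<in> test_functions G. \<forall>y. 0 \<le> f y \<and> f y \<le> 1 \<and>
        (f y \<noteq> 0 \<longrightarrow> dist z y \<le> 2 * r \<and> \<rho> \<le> infdist y (- G)) \<and>
        (dist z y \<le> r \<and> 5 * \<rho> \<le> infdist y (- G) \<longrightarrow> f y = 1) \<and>
        norm (gradient f y) \<le> M / r * indicator (ball z (2 * r)) y
          + M / \<rho> * indicator ({y. \<rho> \<le> infdist y (- G)} \<inter> (\<Union>c\<in>X. ball c (6 * \<rho>))) y)"
proof -
  obtain M where M: "M > 0" and der: "\<And>(c::'a) \<rho> y. \<rho> > 0 \<Longrightarrow> \<exists>f'. (cutoff c \<rho> has_derivative f') (at y) \<and>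
      (\<forall>h. \<bar>f' h\<bar> \<le> M / \<rho> * norm h) \<and>
      (dist y c < \<rho> \<or> 3 / 2 * \<rho> \<le> dist y c \<longrightarrow> (\<forall>h. f' h = 0))"
    using cutoff_derivative by metis
  let ?n = "DIM('a)"
  define M' where "M' = 6 ^ ?n * M"
  have "M \<le> M'" using M by (simp add: M'_def)
  have "\<exists>f \<in> test_functions G. \<forall>y. 0 \<le> f y \<and> f y \<le> 1 \<and>
        (f y \<noteq> 0 \<longrightarrow> dist z y \<le> 2 * r \<and> \<rho> \<le> infdist y (- G)) \<and>
        (dist z y \<le> r \<and> 5 * \<rho> \<le> infdist y (- G) \<longrightarrow> f y = 1) \<and>
        norm (gradient f y) \<le> M' / r * indicator (ball z (2 * r)) y
          + M' / \<rho> * indicator ({y. \<rho> \<le> infdist y (- G)} \<inter> (\<Union>c\<in>X. ball c (6 * \<rho>))) y"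
    if G: "open G" "G \<noteq> UNIV" and X: "finite X" "X \<subseteq> - G" "separated (2 * \<rho>) X"
      "- G \<inter> cball x0 T \<subseteq> (\<Union>c\<in>X. ball c (2 * \<rho>))" and \<rho>: "\<rho> > 0" and r: "r > 0"
      and T: "dist x0 z + 2 * r + \<rho> \<le> T"
    for G X \<rho> r T and x0 z :: 'a
  proof -
    define \<phi> where "\<phi> y = 1 - cutoff z r y" for y
    define \<psi> where "\<psi> y = (\<Prod>c\<in>X. cutoff c (3 * \<rho>) y)" for y
    define f where "f y = \<phi> y * \<psi> y" for y
    have \<phi>: "0 \<le> \<phi> y" "\<phi> y \<le> 1" for y by (auto simp: \<phi>_def cutoff_bounds)
    have \<psi>: "0 \<le> \<psi> y" "\<psi> y \<le> 1" for y
      by (auto simp: \<psi>_def cutoff_bounds intro!: prod_nonneg prod_le_1)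
    have \<phi>0: "\<phi> y = 0" if "3 / 2 * r \<le> dist y z" for y
      using cutoff_eq_1[OF that r] by (simp add: \<phi>_def)
    have \<psi>0: "\<psi> y = 0" if "c \<in> X" "dist y c \<le> 3 * \<rho>" for y c
      using that X(1) cutoff_eq_0[OF that(2)] \<rho> unfolding \<psi>_def by (intro prod_zero) auto
    have away: "\<rho> \<le> infdist y (- G)"
      if "dist y z \<le> 2 * r" "\<And>c. c \<in> X \<Longrightarrow> 3 * \<rho> \<le> dist y c" for y
    proof -
      have "\<rho> \<le> dist y g" if g: "g \<in> - G" for g
      proof (cases "g \<in> cball x0 T")
        case True
        with g X(4) obtain c where "c \<in> X" "dist c g < 2 * \<rho>" by auto
        with \<open>\<And>c. c \<in> X \<Longrightarrow> 3 * \<rho> \<le> dist y c\<close>[of c] dist_triangle2[of y c g] show ?thesis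
          by simp
      next
        case False
        then have "T < dist x0 g" by simp
        also have "\<dots> \<le> dist x0 z + dist z y + dist y g"
          using dist_triangle[of x0 g z] dist_triangle[of z g y] by simp
        finally show ?thesis using T \<open>dist y z \<le> 2 * r\<close> by (simp add: dist_commute)
      qed
      moreover have "- G \<noteq> {}" using G(2) by auto
      ultimately show ?thesis by (intro le_infdistI)
    qed
    have supp: "dist z y \<le> 2 * r \<and> \<rho> \<le> infdist y (- G)" if "f y \<noteq> 0" for y
    proof -
      have "dist y z \<le> 2 * r" using that \<phi>0[of y] r by (force simp: f_def)
      moreover have "3 * \<rho> \<le> dist y c" if "c \<in> X" for c
        using \<psi>0[OF that, of y] \<open>f y \<noteq> 0\<close> by (force simp: f_def)
      ultimately show ?thesis using away by (simp add: dist_commute)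
    qed
    have one: "f y = 1" if "dist z y \<le> r" "5 * \<rho> \<le> infdist y (- G)" for y
    proof -
      have "\<phi> y = 1" using that r cutoff_eq_0[of y z r] by (simp add: \<phi>_def dist_commute)
      moreover have "cutoff c (3 * \<rho>) y = 1" if "c \<in> X" for c
      proof (rule cutoff_eq_1)
        have "infdist y (- G) \<le> dist y c" using X(2) that by (intro infdist_le) auto
        then show "3 / 2 * (3 * \<rho>) \<le> dist y c" using \<open>5 * \<rho> \<le> infdist y (- G)\<close> \<rho> by simp
      qed (use \<rho> in simp)
      ultimately show ?thesis by (simp add: f_def \<psi>_def)
    qed
    have "smooth_term f"
      unfolding f_def \<phi>_def \<psi>_def
      by (intro smooth_term.mult smooth_term_diff smooth_term.const smooth_term_prod smooth_term_cutoff X(1))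
    then have "smooth f" by (rule smooth_term_imp_smooth)
    moreover have sub: "closure {y. f y \<noteq> 0} \<subseteq> cball z (2 * r) \<inter> {y. \<rho> \<le> infdist y (- G)}"
      using supp by (intro closure_minimal closed_Int closed_Collect_le continuous_intros) auto
    moreover have "compact (closure {y. f y \<noteq> 0})"
      using bounded_subset[OF bounded_cball, of _ z "2 * r"] sub
      by (auto simp: compact_eq_bounded_closed)
    moreover have "{y. \<rho> \<le> infdist y (- G)} \<subseteq> G"
    proof
      fix y assume y: "y \<in> {y. \<rho> \<le> infdist y (- G)}"
      show "y \<in> G"
      proof (rule ccontr)
        assume "y \<notin> G"
        then have "infdist y (- G) = 0" by simp
        with y \<rho> show False by simp
      qed
    qed
    ultimately have test: "f \<in> test_functions G" unfolding test_functions_def by blast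
    have grad: "norm (gradient f y) \<le> M' / r * indicator (ball z (2 * r)) y
          + M' / \<rho> * indicator ({y. \<rho> \<le> infdist y (- G)} \<inter> (\<Union>c\<in>X. ball c (6 * \<rho>))) y"
      (is "_ \<le> ?a + ?b") for y
    proof -
      obtain \<phi>' where \<phi>': "(cutoff z r has_derivative \<phi>') (at y)" "\<And>h. \<bar>\<phi>' h\<bar> \<le> M / r * norm h"
          "3 / 2 * r \<le> dist y z \<Longrightarrow> \<phi>' h = 0" for h
        using der[OF r, of z y] by blast
      have "\<forall>c. \<exists>g'. (cutoff c (3 * \<rho>) has_derivative g') (at y) \<and>
          (\<forall>h. \<bar>g' h\<bar> \<le> M / (3 * \<rho>) * norm h) \<and>
          (dist y c < (3 * \<rho>) \<or> 3 / 2 * (3 * \<rho>) \<le> dist y c \<longrightarrow> (\<forall>h. g' h = 0))"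
        using der[of "3 * \<rho>" _ y] \<rho> by simp
      then obtain g' where g': "\<And>c. (cutoff c (3 * \<rho>) has_derivative g' c) (at y)"
        "\<And>c h. \<bar>g' c h\<bar> \<le> M / (3 * \<rho>) * norm h"
        "\<And>c h. dist y c < 3 * \<rho> \<or> 3 / 2 * (3 * \<rho>) \<le> dist y c \<Longrightarrow> g' c h = 0"
        by metis
      define \<psi>' where "\<psi>' h = (\<Sum>c\<in>X. g' c h * (\<Prod>j\<in>X - {c}. cutoff j (3 * \<rho>) y))" for h
      have d\<psi>: "(\<psi> has_derivative \<psi>') (at y)"
        unfolding \<psi>_def \<psi>'_def by (rule has_derivative_prod[OF g'(1)])
      have df: "(f has_derivative (\<lambda>h. \<phi> y * \<psi>' h + (0 - \<phi>' h) * \<psi> y)) (at y)"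
        unfolding f_def \<phi>_def
        by (intro has_derivative_mult has_derivative_diff has_derivative_const \<phi>' d\<psi>)
      have one': "\<bar>\<phi>' h * \<psi> y\<bar> \<le> ?a * norm h" for h
      proof (cases "3 / 2 * r \<le> dist y z")
        case True
        then show ?thesis using \<phi>'(3) M r by (simp add: M'_def)
      next
        case False
        then have "y \<in> ball z (2 * r)" using r by (simp add: dist_commute)
        have "\<bar>\<phi>' h * \<psi> y\<bar> \<le> (M / r * norm h) * 1"
          unfolding abs_mult using \<phi>'(2)[of h] \<psi>[of y] by (intro mult_mono) auto
        also have "\<dots> \<le> M' / r * norm h"
          using \<open>M \<le> M'\<close> r by (auto intro!: mult_right_mono divide_right_mono)
        finally show ?thesis using \<open>y \<in> ball z (2 * r)\<close> by simp
      qed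
      have two: "\<bar>\<phi> y * \<psi>' h\<bar> \<le> ?b * norm h" for h
      proof (cases "\<phi> y = 0 \<or> (\<exists>c\<in>X. dist y c < 3 * \<rho>)")
        case True
        have "\<psi>' h = 0" if c: "c \<in> X" "dist y c < 3 * \<rho>" for c
          unfolding \<psi>'_def
        proof (rule sum.neutral, intro ballI)
          fix j assume j: "j \<in> X"
          show "g' j h * (\<Prod>j\<in>X - {j}. cutoff j (3 * \<rho>) y) = 0"
          proof (cases "j = c")
            case True
            then show ?thesis using c g'(3)[of c h] by simp
          next
            case False
            then have "(\<Prod>j\<in>X - {j}. cutoff j (3 * \<rho>) y) = 0"
              using c X(1) cutoff_eq_0[of y c "3 * \<rho>"] \<rho> by (intro prod_zero) auto
            then show ?thesis by simp
          qed
        qed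
        with True have zero: "\<phi> y * \<psi>' h = 0" by auto
        have "0 \<le> ?b * norm h" using M \<rho> by (simp add: M'_def)
        then show ?thesis unfolding zero by simp
      next
        case False
        then have y: "\<rho> \<le> infdist y (- G)"
          using \<phi>0[of y] r by (intro away) (force simp: not_less)+
        \<comment> \<open>The factors are cut off at radius \<open>3 * \<rho>\<close>, so their derivatives vanish beyond \<open>3 / 2 * (3 * \<rho>) < 5 * \<rho>\<close>.\<close>
        define Y where "Y = {c \<in> X. dist y c \<le> 5 * \<rho>}"
        have Y: "finite Y" "Y \<subseteq> X" using X(1) by (auto simp: Y_def)
        have "real (card Y) * \<rho> ^ ?n \<le> (5 * \<rho> + \<rho>) ^ ?n"
          by (rule card_separated_le[where y=y])
             (use Y X(3) \<rho> in \<open>auto simp: Y_def intro: separated_subset\<close>)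
        also have "\<dots> = 6 ^ ?n * \<rho> ^ ?n" by (simp add: power_mult_distrib flip: distrib_right)
        finally have card: "real (card Y) \<le> 6 ^ ?n" using \<rho> by simp
        have "\<bar>\<psi>' h\<bar> \<le> (\<Sum>c\<in>X. \<bar>g' c h * (\<Prod>j\<in>X - {c}. cutoff j (3 * \<rho>) y)\<bar>)"
          unfolding \<psi>'_def by (rule sum_abs)
        also have "\<dots> \<le> (\<Sum>c\<in>X. \<bar>g' c h\<bar>)"
          unfolding abs_mult
          by (intro sum_mono mult_left_le) (auto simp: cutoff_bounds abs_prod intro!: prod_le_1)
        also have "\<dots> = (\<Sum>c\<in>Y. \<bar>g' c h\<bar>)"
        proof (rule sum.mono_neutral_right)
          show "\<forall>c\<in>X - Y. \<bar>g' c h\<bar> = 0"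
          proof
            fix c assume "c \<in> X - Y"
            then have "3 / 2 * (3 * \<rho>) \<le> dist y c" using \<rho> by (auto simp: Y_def)
            then show "\<bar>g' c h\<bar> = 0" using g'(3)[of c h] by simp
          qed
        qed (use X(1) in \<open>auto simp: Y_def\<close>)
        also have "\<dots> \<le> (\<Sum>c\<in>Y. M / (3 * \<rho>) * norm h)"
          by (intro sum_mono g'(2))
        also have "\<dots> = card Y * (M / (3 * \<rho>) * norm h)" by simp
        finally have le: "\<bar>\<psi>' h\<bar> \<le> card Y * (M / (3 * \<rho>) * norm h)" .
        have "\<bar>\<phi> y * \<psi>' h\<bar> \<le> 1 * (card Y * (M / (3 * \<rho>) * norm h))"
          unfolding abs_mult using \<phi>[of y] le by (intro mult_mono) auto
        also have "\<dots> \<le> ?b * norm h"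
        proof (cases "Y = {}")
          case True
          then show ?thesis using M \<rho> by (simp add: M'_def)
        next
          case False
          then obtain c where "c \<in> X" "dist y c \<le> 5 * \<rho>" by (auto simp: Y_def)
          then have mem: "y \<in> {y. \<rho> \<le> infdist y (- G)} \<inter> (\<Union>c\<in>X. ball c (6 * \<rho>))"
            using y \<rho> by (auto simp: dist_commute intro!: bexI[of _ c])
          have "card Y * (M / (3 * \<rho>) * norm h) \<le> 6 ^ ?n * (M / \<rho> * norm h)"
            using card M \<rho> by (intro mult_mono mult_right_mono) (auto simp: field_simps)
          with mem show ?thesis by (simp add: M'_def)
        qed
        finally show ?thesis .
      qed
      show ?thesis
      proof (rule norm_gradient_le[OF df])
        fix h
        have "\<bar>\<phi> y * \<psi>' h + (0 - \<phi>' h) * \<psi> y\<bar> \<le> \<bar>\<phi> y * \<psi>' h\<bar> + \<bar>\<phi>' h * \<psi> y\<bar>"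
          by (simp add: abs_triangle_ineq4)
        also have "\<dots> \<le> (?a + ?b) * norm h" using one'[of h] two[of h] by (simp add: distrib_right)
        finally show "\<bar>\<phi> y * \<psi>' h + (0 - \<phi>' h) * \<psi> y\<bar> \<le> (?a + ?b) * norm h" .
      qed
    qed
    have "0 \<le> f y" "f y \<le> 1" for y using \<phi>[of y] \<psi>[of y] by (auto simp: f_def mult_le_one)
    with test supp one grad show ?thesis by blast
  qed
  note main = this
  have "M' > 0" using M by (simp add: M'_def)
  show ?thesis
    by (intro exI[of _ M'] conjI allI impI \<open>M' > 0\<close>; elim conjE; rule main; assumption)
qed

section \<open>The Hardy--Sobolev inequality for bumps that meet the boundary\<close>

lemma nn_integral_lincomb:
  assumes [measurable]: "f \<in> borel_measurable M" "g \<in> borel_measurable M"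
  shows "(\<integral>\<^sup>+y. (a * f y + b * g y) \<partial>M) = a * (\<integral>\<^sup>+y. f y \<partial>M) + b * (\<integral>\<^sup>+y. g y \<partial>M)"
  by (simp add: nn_integral_add nn_integral_cmult)

text \<open>Monotone convergence along \<open>\<eta> \<longrightarrow> 0\<close>.\<close>

lemma nn_integral_le_of_superlevels:
  fixes g :: "'a \<Rightarrow> ennreal" and d :: "'a \<Rightarrow> real"
  assumes [measurable]: "g \<in> borel_measurable M" "d \<in> borel_measurable M" "A \<in> sets M"
    and le: "\<And>\<eta>. \<eta> > 0 \<Longrightarrow> (\<integral>\<^sup>+y\<in>A \<inter> {y. \<eta> \<le> d y}. g y \<partial>M) \<le> c"
  shows "(\<integral>\<^sup>+y\<in>A \<inter> {y. 0 < d y}. g y \<partial>M) \<le> c"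
proof -
  let ?F = "\<lambda>(i::nat) y. g y * indicator (A \<inter> {y. inverse (real (Suc i)) \<le> d y}) y"
  have "(\<integral>\<^sup>+y\<in>A \<inter> {y. 0 < d y}. g y \<partial>M) \<le> (\<integral>\<^sup>+y. (SUP i. ?F i y) \<partial>M)"
  proof (rule nn_integral_mono)
    fix y
    show "g y * indicator (A \<inter> {y. 0 < d y}) y \<le> (SUP i. ?F i y)"
    proof (cases "y \<in> A \<and> 0 < d y")
      case True
      then obtain i where "inverse (real (Suc i)) < d y" using reals_Archimedean by blast
      with True have "g y * indicator (A \<inter> {y. 0 < d y}) y \<le> ?F i y" by simp
      then show ?thesis by (rule order_trans) (rule SUP_upper, simp)
    qed auto
  qed
  also have "\<dots> = (SUP i. \<integral>\<^sup>+y. ?F i y \<partial>M)"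
  proof (rule nn_integral_monotone_convergence_SUP)
    show "incseq ?F"
    proof (intro incseq_SucI le_funI mult_left_mono)
      fix i y
      have "inverse (real (Suc (Suc i))) \<le> inverse (real (Suc i))" by (simp add: divide_simps)
      then have "A \<inter> {y. inverse (real (Suc i)) \<le> d y} \<subseteq> A \<inter> {y. inverse (real (Suc (Suc i))) \<le> d y}"
        using order_trans by blast
      then show "(indicator (A \<inter> {y. inverse (real (Suc i)) \<le> d y}) y :: ennreal)
          \<le> indicator (A \<inter> {y. inverse (real (Suc (Suc i))) \<le> d y}) y"
        by (auto intro!: indicator_leI)
    qed simp
  qed simp
  also have "\<dots> \<le> c" by (intro SUP_least le) simp
  finally show ?thesis .
qed

lemma powr_add_le:
  fixes a b p :: real
  assumes "0 \<le> a" "0 \<le> b" "0 \<le> p"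
  shows "(a + b) powr p \<le> 2 powr p * (a powr p + b powr p)"
proof -
  have "(a + b) powr p \<le> (2 * max a b) powr p"
    using assms by (intro powr_mono2) auto
  also have "\<dots> = 2 powr p * max a b powr p" using assms by (simp add: powr_mult)
  also have "max a b powr p \<le> a powr p + b powr p" by (simp add: max_def)
  finally show ?thesis by simp
qed

text \<open>The inequality holds for bumps that do not vanish near the complement of \<open>G\<close>. The test
  function of \<open>exists_test_function\<close> differs from the bump only near the net \<open>X\<close>, and this costs an energy of order
  \<open>card X * \<rho> powr d\<close>: each net point contributes a ball of volume about \<open>\<rho> ^ DIM('a)\<close>, a gradient of
  size \<open>1 / \<rho>\<close> and a weight at most \<open>\<rho> powr \<beta>\<close>. As \<open>card X\<close> is at most the covering number
  at scale \<open>\<rho>\<close>, the smallness of the Minkowski content makes the cost negligible along a sequence of scales.\<close>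

lemma hardy_sobolev_local:
  fixes G :: "'a::euclidean_space set" and \<beta> p q l d :: real
  defines "d \<equiv> real DIM('a) - p + \<beta>"
  defines "e \<equiv> q / p * d - real DIM('a)"
  assumes G: "open G" "frontier G \<noteq> {}"
    and p: "1 \<le> p" and q: "0 < q" and \<beta>: "\<beta> \<le> 0" and e: "e \<le> 0"
    and hs: "hardy_sobolev q p \<beta> G"
    and l: "l \<le> d" "\<And>\<epsilon>. \<epsilon> > 0 \<Longrightarrow>
      \<exists>\<rho>. 0 < \<rho> \<and> \<rho> < \<epsilon> \<and> real (covering_number (- G \<inter> cball x0 T) \<rho>) * \<rho> powr l < \<epsilon>"
  shows "\<exists>C>0. \<forall>z r w. r > 0 \<and> w > 0 \<and> dist x0 z + 2 * r < T \<and>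
       (\<integral>\<^sup>+y\<in>ball z (2 * r) \<inter> G. ennreal (infdist y (- G) powr \<beta>) \<partial>lborel) \<le> ennreal w \<longrightarrow>
     (\<integral>\<^sup>+y\<in>ball z r \<inter> G. ennreal (infdist y (- G) powr e) \<partial>lborel)
       \<le> ennreal (C * (r powr (- p) * w) powr (q / p))"
proof -
  let ?n = "DIM('a)" and ?E = "- G \<inter> cball x0 T"
  let ?d = "\<lambda>y. infdist y (- G)"
  have GU: "G \<noteq> UNIV" using G(2) by auto
  then have "- G \<noteq> {}" by auto
  have [measurable]: "G \<in> sets borel" using G(1) by (rule borel_open)
  have [measurable]: "ball c t \<in> sets borel" for c :: 'a and t by simp
  have [measurable]: "?d \<in> borel_measurable borel"
    by (intro borel_measurable_continuous_onI continuous_intros)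
  have Gpos: "y \<in> G \<longleftrightarrow> 0 < ?d y" for y
    using in_closed_iff_infdist_zero[of "- G" y] G(1) \<open>- G \<noteq> {}\<close> infdist_nonneg[of y "- G"]
    by (auto simp: less_le)
  obtain C0 where C0: "C0 > 0" and hs: "\<And>f. f \<in> test_functions G \<Longrightarrow>
     (\<integral>x\<in>G. (\<bar>f x\<bar> powr q * infdist x (frontier G) powr e) \<partial>lborel) powr (1 / q)
     \<le> C0 * (\<integral>x\<in>G. (norm (gradient f x) powr p * infdist x (frontier G) powr \<beta>) \<partial>lborel) powr (1 / p)"
    using hs unfolding hardy_sobolev_def e_def d_def by blast
  obtain M where M: "M > 0" and tf: "\<forall>(G::'a set) X \<rho> r x0 z T.
      open G \<and> G \<noteq> UNIV \<and> finite X \<and> X \<subseteq> - G \<and> separated (2 * \<rho>) X \<and>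
      - G \<inter> cball x0 T \<subseteq> (\<Union>c\<in>X. ball c (2 * \<rho>)) \<and> \<rho> > 0 \<and> r > 0 \<and>
      dist x0 z + 2 * r + \<rho> \<le> T \<longrightarrow>
      (\<exists>f \<in> test_functions G. \<forall>y. 0 \<le> f y \<and> f y \<le> 1 \<and>
        (f y \<noteq> 0 \<longrightarrow> dist z y \<le> 2 * r \<and> \<rho> \<le> infdist y (- G)) \<and>
        (dist z y \<le> r \<and> 5 * \<rho> \<le> infdist y (- G) \<longrightarrow> f y = 1) \<and>
        norm (gradient f y) \<le> M / r * indicator (ball z (2 * r)) y
          + M / \<rho> * indicator ({y. \<rho> \<le> infdist y (- G)} \<inter> (\<Union>c\<in>X. ball c (6 * \<rho>))) y)"
    using exists_test_function[where 'a='a] by (elim exE conjE)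
  define C where "C = C0 powr q * (2 powr p * (M powr p + 1)) powr (q / p)"
  have Mp: "M powr p + 1 > 0" by (simp add: add_nonneg_pos)
  have "C > 0" using C0 less_imp_neq[OF Mp] by (simp add: C_def)
  have "(\<integral>\<^sup>+y\<in>ball z r \<inter> G. ennreal (?d y powr e) \<partial>lborel)
       \<le> ennreal (C * (r powr (- p) * w) powr (q / p))"
    if r: "r > 0" and w: "w > 0" and z: "dist x0 z + 2 * r < T"
      and int: "(\<integral>\<^sup>+y\<in>ball z (2 * r) \<inter> G. ennreal (?d y powr \<beta>) \<partial>lborel) \<le> ennreal w"
    for z r w
  proof -
    have "(\<integral>\<^sup>+y\<in>ball z r \<inter> {y. 0 < ?d y}. ennreal (?d y powr e) \<partial>lborel)
       \<le> ennreal (C * (r powr (- p) * w) powr (q / p))"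
    proof (rule nn_integral_le_of_superlevels)
      fix \<eta> :: real assume \<eta>: "\<eta> > 0"
      define D where "D = M powr p * (unit_ball_vol ?n * 6 ^ ?n)"
      have D: "D > 0" using M by (simp add: D_def)
      \<comment> \<open>The last entry brings the energy near the net below the bound for the bump; the others give \<open>\<rho> \<le> 1\<close>, leave the bump
        untouched where the distance is at least \<open>\<eta>\<close>, and keep the support in the region that \<open>X\<close> protects.\<close>
      define \<epsilon> where "\<epsilon> = Min {1, \<eta> / 5, T - (dist x0 z + 2 * r), r powr (- p) * w / D}"
      have "\<epsilon> > 0" using \<eta> z w D r by (simp add: \<epsilon>_def)
      then obtain \<rho> where \<rho>: "0 < \<rho>" "\<rho> < \<epsilon>" "real (covering_number ?E \<rho>) * \<rho> powr l < \<epsilon>"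
        using l(2) by blast
      have \<rho>': "\<rho> \<le> 1" "5 * \<rho> \<le> \<eta>" "dist x0 z + 2 * r + \<rho> \<le> T" and
        cov: "real (covering_number ?E \<rho>) * \<rho> powr l \<le> r powr (- p) * w / D"
        using \<rho> by (simp_all add: \<epsilon>_def)
      have "bounded ?E" by (simp add: bounded_Int)
      then obtain X where X: "finite X" "X \<subseteq> ?E" "separated (2 * \<rho>) X" "?E \<subseteq> (\<Union>c\<in>X. ball c (2 * \<rho>))"
        using exists_maximal_separated[of ?E "2 * \<rho>"] \<rho>(1) by auto
      have "card X \<le> covering_number ?E \<rho>"
        by (rule card_separated_le_covering_number) (use X \<rho>(1) \<open>bounded ?E\<close> in auto)
      then have "real (card X) * \<rho> powr l \<le> r powr (- p) * w / D"
        using cov by (meson mult_right_mono of_nat_le_iff order_trans powr_ge_zero)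
      moreover have "\<rho> powr d \<le> \<rho> powr l"
        using \<rho>(1) \<rho>' l(1) by (intro powr_mono') auto
      ultimately have "real (card X) * \<rho> powr d \<le> r powr (- p) * w / D"
        by (meson mult_left_mono of_nat_0_le_iff order_trans)
      then have cardX: "D * (real (card X) * \<rho> powr d) \<le> r powr (- p) * w"
        using D by (simp add: field_simps)
      obtain f where f: "f \<in> test_functions G" and f01: "\<And>y. 0 \<le> f y" "\<And>y. f y \<le> 1"
        and supp: "\<And>y. f y \<noteq> 0 \<Longrightarrow> dist z y \<le> 2 * r \<and> \<rho> \<le> ?d y"
        and f1: "\<And>y. dist z y \<le> r \<Longrightarrow> 5 * \<rho> \<le> ?d y \<Longrightarrow> f y = 1"
        and grad: "\<And>y. norm (gradient f y) \<le> M / r * indicator (ball z (2 * r)) y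
          + M / \<rho> * indicator ({y. \<rho> \<le> ?d y} \<inter> (\<Union>c\<in>X. ball c (6 * \<rho>))) y"
        using tf[rule_format, of G X \<rho> x0 T r z] G(1) GU X \<rho>(1) r \<rho>'(3) by auto
      define u where "u y = indicator G y * (\<bar>f y\<bar> powr q * infdist y (frontier G) powr e)" for y
      define v where "v y = indicator G y * (norm (gradient f y) powr p * infdist y (frontier G) powr \<beta>)" for y
      define N where "N = 2 powr p * ((M powr p + 1) * (r powr (- p) * w))"
      have "N > 0" using Mp r w by (simp add: N_def)
      have "continuous_on UNIV f"
        using f unfolding test_functions_def smooth_def using Ck.simps(1) by blast
      then have [measurable]: "f \<in> borel_measurable borel"
        by (rule borel_measurable_continuous_onI)
      have ueq: "u y = indicator G y * (\<bar>f y\<bar> powr q * ?d y powr e)" for y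
        using infdist_frontier_eq[OF G, of y] by (auto simp: u_def indicator_def)
      have veq: "v y = indicator G y * (norm (gradient f y) powr p * ?d y powr \<beta>)" for y
        using infdist_frontier_eq[OF G, of y] by (auto simp: v_def indicator_def)
      have HS: "(\<integral>y. u y \<partial>lborel) powr (1 / q) \<le> C0 * (\<integral>y. v y \<partial>lborel) powr (1 / p)"
        using hs[OF f] by (simp add: set_lebesgue_integral_def u_def v_def)
      have u0: "0 \<le> u y" for y by (simp add: u_def)
      \<comment> \<open>A non-integrable function has Bochner integral \<open>0\<close>, so the lower bound below rests on integrability.\<close>
      have "integrable lborel u"
      proof (rule integrableI_bounded_set)
        show "ball z (3 * r) \<in> sets lborel" by simp
        show "u \<in> borel_measurable lborel" unfolding ueq[abs_def] by measurable
        show "emeasure lborel (ball z (3 * r)) < \<infinity>" by (rule emeasure_lborel_ball_finite)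
        show "AE y in lborel. y \<in> ball z (3 * r) \<longrightarrow> norm (u y) \<le> \<rho> powr e"
        proof (intro AE_I2 impI)
          fix y
          show "norm (u y) \<le> \<rho> powr e"
          proof (cases "f y = 0")
            case False
            with supp have "\<rho> \<le> ?d y" by blast
            then have "?d y powr e \<le> \<rho> powr e" using \<rho>(1) e by (intro powr_mono2') auto
            moreover have "\<bar>f y\<bar> powr q \<le> 1" using f01 q by (intro powr_le1) auto
            ultimately have "\<bar>f y\<bar> powr q * ?d y powr e \<le> 1 * \<rho> powr e"
              by (intro mult_mono) auto
            then show ?thesis by (simp add: ueq indicator_def)
          qed (simp add: ueq)
        qed
        show "AE y in lborel. y \<notin> ball z (3 * r) \<longrightarrow> u y = 0"
        proof (intro AE_I2 impI)
          fix y assume "y \<notin> ball z (3 * r)"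
          then have "f y = 0" using supp[of y] r by force
          then show "u y = 0" by (simp add: u_def)
        qed
      qed
      have lower: "(\<integral>\<^sup>+y\<in>ball z r \<inter> {y. \<eta> \<le> ?d y}. ennreal (?d y powr e) \<partial>lborel)
          \<le> ennreal (\<integral>y. u y \<partial>lborel)"
      proof -
        have "(\<integral>\<^sup>+y\<in>ball z r \<inter> {y. \<eta> \<le> ?d y}. ennreal (?d y powr e) \<partial>lborel)
            \<le> (\<integral>\<^sup>+y. ennreal (u y) \<partial>lborel)"
        proof (rule nn_integral_mono)
          fix y
          show "ennreal (?d y powr e) * indicator (ball z r \<inter> {y. \<eta> \<le> ?d y}) y \<le> ennreal (u y)"
          proof (cases "y \<in> ball z r \<inter> {y. \<eta> \<le> ?d y}")
            case True
            then have "f y = 1" using \<rho>'(2) by (intro f1) auto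
            moreover have "y \<in> G" using True \<eta> by (simp add: Gpos)
            ultimately show ?thesis by (simp add: ueq indicator_def)
          qed simp
        qed
        also have "\<dots> = ennreal (\<integral>y. u y \<partial>lborel)"
          by (rule nn_integral_eq_integral[OF \<open>integrable lborel u\<close>]) (simp add: u0)
        finally show ?thesis .
      qed
      have upper: "(\<integral>y. v y \<partial>lborel) \<le> N"
      proof (rule integral_real_bounded)
        show "0 \<le> N" using \<open>N > 0\<close> by simp
        let ?K = "2 powr p * (M / r) powr p" and ?L = "2 powr p * ((M / \<rho>) powr p * \<rho> powr \<beta>)"
        have pt: "ennreal (v y) \<le> ennreal ?K * (ennreal (?d y powr \<beta>) * indicator (ball z (2 * r) \<inter> G) y)
             + ennreal ?L * (\<Sum>c\<in>X. indicator (ball c (6 * \<rho>)) y)" for y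
        proof (cases "y \<in> G")
          case True
          let ?S = "{y. \<rho> \<le> ?d y} \<inter> (\<Union>c\<in>X. ball c (6 * \<rho>))"
          have i: "(a * indicator A y) powr p = a powr p * indicator A y" for A :: "'a set" and a
            by (simp add: indicator_def)
          have near_net: "?d y powr \<beta> * indicator ?S y \<le> \<rho> powr \<beta> * (\<Sum>c\<in>X. indicator (ball c (6 * \<rho>)) y)"
          proof (cases "y \<in> ?S")
            case True
            then obtain c where c: "c \<in> X" "y \<in> ball c (6 * \<rho>)" by blast
            have "(1::real) = indicator (ball c (6 * \<rho>)) y" using c by simp
            also have "\<dots> \<le> (\<Sum>c\<in>X. indicator (ball c (6 * \<rho>)) y)"
              using c X(1) by (intro member_le_sum) auto
            finally have "?d y powr \<beta> * 1 \<le> \<rho> powr \<beta> * (\<Sum>c\<in>X. indicator (ball c (6 * \<rho>)) y)"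
              using True \<rho>(1) \<beta> by (intro mult_mono powr_mono2') auto
            with True show ?thesis by simp
          qed (simp add: sum_nonneg)
          have "norm (gradient f y) powr p \<le> (M / r * indicator (ball z (2 * r)) y + M / \<rho> * indicator ?S y) powr p"
            using grad p by (intro powr_mono2) auto
          also have "\<dots> \<le> 2 powr p * ((M / r * indicator (ball z (2 * r)) y) powr p + (M / \<rho> * indicator ?S y) powr p)"
            using p M r \<rho>(1) by (intro powr_add_le) auto
          also have "\<dots> = ?K * indicator (ball z (2 * r)) y + 2 powr p * (M / \<rho>) powr p * indicator ?S y"
            unfolding i by (simp add: distrib_left mult.assoc)
          finally have "norm (gradient f y) powr p * ?d y powr \<beta>
            \<le> (?K * indicator (ball z (2 * r)) y + 2 powr p * (M / \<rho>) powr p * indicator ?S y) * ?d y powr \<beta>"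
            by (intro mult_right_mono) auto
          also have "\<dots> = ?K * (?d y powr \<beta> * indicator (ball z (2 * r)) y) 
              + 2 powr p * (M / \<rho>) powr p * (?d y powr \<beta> * indicator ?S y)"
            by (simp add: algebra_simps)
          also have "\<dots> \<le> ?K * (?d y powr \<beta> * indicator (ball z (2 * r)) y)
              + 2 powr p * (M / \<rho>) powr p * (\<rho> powr \<beta> * (\<Sum>c\<in>X. indicator (ball c (6 * \<rho>)) y))"
            by (intro add_left_mono mult_left_mono near_net) simp
          finally have "norm (gradient f y) powr p * ?d y powr \<beta> \<le>
             ?K * (?d y powr \<beta> * indicator (ball z (2 * r)) y) + ?L * (\<Sum>c\<in>X. indicator (ball c (6 * \<rho>)) y)"
            by (simp add: mult.assoc)
          then have "ennreal (v y) \<le> ennreal (?K * (?d y powr \<beta> * indicator (ball z (2 * r)) y) + ?L * (\<Sum>c\<in>X. indicator (ball c (6 * \<rho>)) y))"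
            using True by (intro ennreal_leI) (simp add: veq)
          also have "\<dots> = ennreal ?K * (ennreal (?d y powr \<beta>) * indicator (ball z (2 * r) \<inter> G) y)
             + ennreal ?L * (\<Sum>c\<in>X. indicator (ball c (6 * \<rho>)) y)"
            using True
            by (simp add: ennreal_plus ennreal_mult sum_nonneg ennreal_indicator indicator_inter_arith flip: sum_ennreal)
          finally show ?thesis .
        qed (simp add: v_def)
        have "(\<integral>\<^sup>+y. ennreal (v y) \<partial>lborel) \<le>
            (\<integral>\<^sup>+y. (ennreal ?K * (ennreal (?d y powr \<beta>) * indicator (ball z (2 * r) \<inter> G) y)
             + ennreal ?L * (\<Sum>c\<in>X. indicator (ball c (6 * \<rho>)) y)) \<partial>lborel)"
          by (intro nn_integral_mono pt)
        also have "\<dots> = ennreal ?K * (\<integral>\<^sup>+y\<in>ball z (2 * r) \<inter> G. ennreal (?d y powr \<beta>) \<partial>lborel)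
            + ennreal ?L * (\<Sum>c\<in>X. emeasure lborel (ball c (6 * \<rho>)))"
        proof -
          have m1: "(\<lambda>y. indicator (ball c (6 * \<rho>)) y :: ennreal) \<in> borel_measurable lborel" for c
            by (rule borel_measurable_indicator) simp
          have m2: "(\<lambda>y. ennreal (?d y powr \<beta>) * indicator (ball z (2 * r) \<inter> G) y) \<in> borel_measurable lborel"
            by measurable
          show ?thesis
            by (subst nn_integral_lincomb[OF m2 borel_measurable_sum[OF m1]], subst nn_integral_sum[OF m1]) simp
        qed
        also have "\<dots> \<le> ennreal ?K * ennreal w + ennreal ?L * (\<Sum>c\<in>X. emeasure lborel (ball c (6 * \<rho>)))"
          by (intro add_right_mono mult_left_mono int) auto
        also have "\<dots> = ennreal (?K * w + ?L * (card X * (unit_ball_vol ?n * (6 * \<rho>) ^ ?n)))"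
          using w \<rho>(1)
          by (simp add: emeasure_ball ennreal_plus ennreal_mult ennreal_of_nat_eq_real_of_nat)
        also have "?K * w + ?L * (card X * (unit_ball_vol ?n * (6 * \<rho>) ^ ?n))
            = 2 powr p * (M powr p * (r powr (- p) * w) + D * (card X * \<rho> powr d))"
        proof -
          have "(M / r) powr p = M powr p * r powr (- p)" "(M / \<rho>) powr p = M powr p * \<rho> powr (- p)"
            using M r \<rho>(1) by (simp_all add: powr_divide powr_minus_divide)
          moreover have "\<rho> powr d = \<rho> ^ ?n * \<rho> powr (- p) * \<rho> powr \<beta>"
            using \<rho>(1) by (simp add: d_def powr_diff powr_add powr_realpow powr_minus_divide)
          ultimately show ?thesis by (simp add: D_def power_mult_distrib algebra_simps)
        qed
        also have "\<dots> \<le> N"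
          using cardX unfolding N_def by (intro mult_left_mono) (auto simp: algebra_simps)
        finally show "(\<integral>\<^sup>+y. ennreal (v y) \<partial>lborel) \<le> ennreal N" by (simp add: ennreal_leI)
      qed
      define I where "I = (\<integral>y. u y \<partial>lborel)"
      have I0: "0 \<le> I" unfolding I_def by (simp add: u0)
      have J0: "0 \<le> (\<integral>y. v y \<partial>lborel)" by (simp add: v_def)
      have "I powr (1 / q) \<le> C0 * N powr (1 / p)"
      proof -
        have "(\<integral>y. v y \<partial>lborel) powr (1 / p) \<le> N powr (1 / p)"
          using upper J0 p by (intro powr_mono2) auto
        with HS C0 show ?thesis unfolding I_def by (meson mult_left_mono order_trans less_imp_le)
      qed
      then have "(I powr (1 / q)) powr q \<le> (C0 * N powr (1 / p)) powr q"
        using q by (intro powr_mono2) auto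
      then have "I \<le> C0 powr q * N powr (q / p)"
        using q I0 C0 by (simp add: powr_powr powr_mult)
      also have "\<dots> = C * (r powr (- p) * w) powr (q / p)"
        using M r w by (simp add: C_def N_def powr_mult mult.assoc)
      finally have "ennreal I \<le> ennreal (C * (r powr (- p) * w) powr (q / p))" by (rule ennreal_leI)
      with lower show "(\<integral>\<^sup>+y\<in>ball z r \<inter> {y. \<eta> \<le> ?d y}. ennreal (?d y powr e) \<partial>lborel)
          \<le> ennreal (C * (r powr (- p) * w) powr (q / p))" unfolding I_def by (rule order_trans)
    qed simp_all
    moreover have "G = {y. 0 < ?d y}" using Gpos by blast
    ultimately show ?thesis by simp
  qed
  with \<open>C > 0\<close> show ?thesis by blast
qed

section \<open>Sublinear iteration over scales\<close>

text \<open>Either the left side is at most \<open>T\<close>, or its excess is absorbed by its power with exponent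
  \<open>e / \<beta> > 1\<close>. Used in place of Hoelder's inequality, this keeps the level \<open>T\<close> free.\<close>

lemma powr_le_interpolate:
  fixes \<delta> T \<beta> e :: real
  assumes "\<delta> > 0" "T > 0" "\<beta> < 0" "e < \<beta>"
  shows "\<delta> powr \<beta> \<le> T + T powr (1 - e / \<beta>) * \<delta> powr e"
proof (cases "\<delta> powr \<beta> \<le> T")
  case True
  have "0 \<le> T powr (1 - e / \<beta>) * \<delta> powr e" by simp
  with True show ?thesis by linarith
next
  case False
  have "1 - e / \<beta> \<le> 0" using assms by (simp add: field_simps)
  have "\<delta> powr \<beta> = (\<delta> powr \<beta>) powr (1 - e / \<beta>) * \<delta> powr e"
    using assms by (simp add: powr_powr right_diff_distrib flip: powr_add)
  also have "\<dots> \<le> T powr (1 - e / \<beta>) * \<delta> powr e"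
    using False assms(2) \<open>1 - e / \<beta> \<le> 0\<close> by (intro mult_right_mono powr_mono2') auto
  finally show ?thesis using assms(2) by simp
qed

text \<open>Put \<open>a(r)\<close> for the integral of \<open>\<delta> powr \<beta>\<close> over the ball of radius \<open>r\<close>, divided by its natural
  size \<open>r powr (n + \<beta>)\<close> with \<open>n = DIM('a)\<close>. Since \<open>\<delta> powr e\<close> is a power of \<open>\<delta> powr \<beta>\<close> with exponent \<open>\<gamma> = e / \<beta>\<close>, the local
  inequality combined with interpolation gives \<open>a(r) \<le> K1 * a(2 * r) powr \<theta>\<close> with \<open>\<theta> = q / (p * \<gamma>)\<close>. The
  hypothesis \<open>e < q / p * \<beta>\<close>, which is the subcriticality of \<open>q\<close>, says exactly that \<open>\<theta> < 1\<close>. Such a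
  recursion preserves the bound \<open>a \<le> L\<close> for large \<open>L\<close>, so the mere integrability at the top scale propagates
  to all smaller scales. Inserting this bound into the local inequality once more gives the conclusion.\<close>

lemma integral_growth_bootstrap:
  fixes A G :: "'a::euclidean_space set" and \<delta> :: "'a \<Rightarrow> real" and p q \<beta> \<rho> W C :: real
  defines "d \<equiv> real DIM('a) - p + \<beta>"
  defines "e \<equiv> q / p * d - real DIM('a)"
  assumes [measurable]: "\<delta> \<in> borel_measurable borel" "G \<in> sets borel"
    and pos: "\<And>y. y \<in> G \<Longrightarrow> 0 < \<delta> y"
    and par: "0 < p" "0 < q" "\<beta> < 0" "0 < d" "e < q / p * \<beta>" "e < \<beta>" and \<rho>: "0 < \<rho>" and C: "0 < C"
    and local: "\<And>z r w. \<lbrakk>z \<in> A; 0 < r; r \<le> \<rho>; w > 0;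
       (\<integral>\<^sup>+y\<in>ball z (2 * r) \<inter> G. ennreal (\<delta> y powr \<beta>) \<partial>lborel) \<le> ennreal w\<rbrakk> \<Longrightarrow>
     (\<integral>\<^sup>+y\<in>ball z r \<inter> G. ennreal (\<delta> y powr e) \<partial>lborel) \<le> ennreal (C * (r powr (- p) * w) powr (q / p))"
    and W: "\<And>z. z \<in> A \<Longrightarrow> (\<integral>\<^sup>+y\<in>ball z (2 * \<rho>) \<inter> G. ennreal (\<delta> y powr \<beta>) \<partial>lborel) \<le> ennreal W"
  shows "\<exists>K>0. \<forall>z\<in>A. \<forall>r. 0 < r \<and> r \<le> \<rho> \<longrightarrow>
     (\<integral>\<^sup>+y\<in>ball z r \<inter> G. ennreal (\<delta> y powr e) \<partial>lborel) \<le> ennreal (K * r powr (q / p * d))"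
proof -
  let ?n = "DIM('a)"
  have [measurable]: "ball c t \<in> sets borel" for c :: 'a and t by simp
  define \<gamma> where "\<gamma> = e / \<beta>"
  define \<theta> where "\<theta> = q / (p * \<gamma>)"
  have \<gamma>: "q / p < \<gamma>" using par by (simp add: \<gamma>_def neg_less_divide_eq)
  then have "0 < \<gamma>" using par by (smt (verit) divide_pos_pos)
  have \<theta>: "\<theta> < 1" using \<gamma> \<open>0 < \<gamma>\<close> par by (simp add: \<theta>_def field_simps)
  have \<theta>\<gamma>: "\<theta> * \<gamma> = q / p" using \<open>0 < \<gamma>\<close> par by (simp add: \<theta>_def)
  have n\<beta>: "0 < ?n + \<beta>" using par by (simp add: d_def)
  define K1 where "K1 = unit_ball_vol ?n + C * (2 powr (?n + \<beta>)) powr (q / p)"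
  have K1: "K1 > 0" using C by (simp add: K1_def add_pos_pos)
  define L where "L = Max {K1 powr (1 / (1 - \<theta>)), W / \<rho> powr (?n + \<beta>)}"
  have L: "K1 powr (1 / (1 - \<theta>)) \<le> L" "W / \<rho> powr (?n + \<beta>) \<le> L" by (simp_all add: L_def)
  then have L0: "L > 0" using K1 by (smt (verit) powr_gt_zero)
  have L1: "K1 * L powr \<theta> \<le> L"
  proof -
    have "K1 = (K1 powr (1 / (1 - \<theta>))) powr (1 - \<theta>)" using K1 \<theta> by (simp add: powr_powr)
    also have "\<dots> \<le> L powr (1 - \<theta>)" using L(1) \<theta> by (intro powr_mono2) auto
    finally have "K1 * L powr \<theta> \<le> L powr (1 - \<theta>) * L powr \<theta>" by (intro mult_right_mono) auto
    also have "\<dots> = L" using L0 by (simp flip: powr_add)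
    finally show ?thesis .
  qed
  let ?I = "\<lambda>z r. \<integral>\<^sup>+y\<in>ball z r \<inter> G. ennreal (\<delta> y powr \<beta>) \<partial>lborel"
  let ?J = "\<lambda>z r. \<integral>\<^sup>+y\<in>ball z r \<inter> G. ennreal (\<delta> y powr e) \<partial>lborel"
  have J: "?J z r \<le> ennreal (C * (2 powr (?n + \<beta>)) powr (q / p) * L powr (q / p) * r powr (q / p * d))"
    if z: "z \<in> A" and r: "0 < r" "r \<le> \<rho>" and I: "?I z (2 * r) \<le> ennreal (L * (2 * r) powr (?n + \<beta>))"
    for z r
  proof -
    have "?J z r \<le> ennreal (C * (r powr (- p) * (L * (2 * r) powr (?n + \<beta>))) powr (q / p))"
      by (rule local[OF z r _ I]) (use L0 r in simp)
    also have "r powr (- p) * (L * (2 * r) powr (?n + \<beta>)) = 2 powr (?n + \<beta>) * L * r powr d"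
    proof -
      have "r powr (- p) * r powr (?n + \<beta>) = r powr d" using r by (simp add: d_def algebra_simps flip: powr_add)
      then show ?thesis using r by (simp add: powr_mult mult_ac)
    qed
    also have "C * (2 powr (?n + \<beta>) * L * r powr d) powr (q / p) =
        C * (2 powr (?n + \<beta>)) powr (q / p) * L powr (q / p) * r powr (q / p * d)"
      using r L0 by (simp add: powr_mult powr_powr mult_ac)
    finally show ?thesis .
  qed
  have step: "?I z r \<le> ennreal (L * r powr (?n + \<beta>))"
    if z: "z \<in> A" and r: "0 < r" "r \<le> \<rho>" and I: "?I z (2 * r) \<le> ennreal (L * (2 * r) powr (?n + \<beta>))"
    for z r
  proof -
    \<comment> \<open>This level balances the two terms: both become multiples of \<open>L powr \<theta> * r powr (DIM('a) + \<beta>)\<close>.\<close>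
    define T where "T = L powr \<theta> * r powr \<beta>"
    have T: "T > 0" using L0 r by (simp add: T_def)
    have "?I z r \<le> (\<integral>\<^sup>+y. (ennreal T * indicator (ball z r) y
        + ennreal (T powr (1 - \<gamma>)) * (ennreal (\<delta> y powr e) * indicator (ball z r \<inter> G) y)) \<partial>lborel)"
    proof (rule nn_integral_mono)
      fix y
      show "ennreal (\<delta> y powr \<beta>) * indicator (ball z r \<inter> G) y \<le> ennreal T * indicator (ball z r) y
        + ennreal (T powr (1 - \<gamma>)) * (ennreal (\<delta> y powr e) * indicator (ball z r \<inter> G) y)"
      proof (cases "y \<in> ball z r \<inter> G")
        case True
        then have "\<delta> y powr \<beta> \<le> T + T powr (1 - \<gamma>) * \<delta> y powr e"
          unfolding \<gamma>_def using pos T par by (intro powr_le_interpolate) auto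
        then have "ennreal (\<delta> y powr \<beta>) \<le> ennreal (T + T powr (1 - \<gamma>) * \<delta> y powr e)"
          by (rule ennreal_leI)
        with True T show ?thesis by (simp add: ennreal_plus ennreal_mult)
      qed simp
    qed
    also have "\<dots> = ennreal T * emeasure lborel (ball z r) + ennreal (T powr (1 - \<gamma>)) * ?J z r"
    proof -
      have m1: "(\<lambda>y. indicator (ball z r) y :: ennreal) \<in> borel_measurable lborel"
        by measurable
      have m2: "(\<lambda>y. ennreal (\<delta> y powr e) * indicator (ball z r \<inter> G) y) \<in> borel_measurable lborel"
        by measurable
      show ?thesis by (subst nn_integral_lincomb[OF m1 m2]) simp
    qed
    also have "\<dots> \<le> ennreal T * ennreal (unit_ball_vol ?n * r ^ ?n) + ennreal (T powr (1 - \<gamma>)) *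
       ennreal (C * (2 powr (?n + \<beta>)) powr (q / p) * L powr (q / p) * r powr (q / p * d))"
      using emeasure_ball[of r z] r by (intro add_mono mult_left_mono J[OF z r I]) auto
    also have "\<dots> = ennreal (T * (unit_ball_vol ?n * r ^ ?n) + T powr (1 - \<gamma>) *
       (C * (2 powr (?n + \<beta>)) powr (q / p) * L powr (q / p) * r powr (q / p * d)))"
      using T r C L0 by (simp add: ennreal_plus ennreal_mult)
    also have "T * (unit_ball_vol ?n * r ^ ?n) + T powr (1 - \<gamma>) *
       (C * (2 powr (?n + \<beta>)) powr (q / p) * L powr (q / p) * r powr (q / p * d))
       = K1 * L powr \<theta> * r powr (?n + \<beta>)"
    proof -
      have a: "T * r ^ ?n = L powr \<theta> * r powr (?n + \<beta>)"
        using r by (simp add: T_def powr_add powr_realpow)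
      have "\<theta> * (1 - \<gamma>) + q / p = \<theta>" using \<theta>\<gamma> by (simp add: right_diff_distrib)
      moreover have "\<beta> * (1 - \<gamma>) + q / p * d = ?n + \<beta>"
        using par(3) by (simp add: \<gamma>_def e_def field_simps)
      moreover have "T powr (1 - \<gamma>) * (L powr (q / p) * r powr (q / p * d))
          = L powr (\<theta> * (1 - \<gamma>) + q / p) * r powr (\<beta> * (1 - \<gamma>) + q / p * d)"
        using r L0 by (simp add: T_def powr_mult powr_powr powr_add)
      ultimately have b: "T powr (1 - \<gamma>) * (L powr (q / p) * r powr (q / p * d))
          = L powr \<theta> * r powr (?n + \<beta>)" by simp
      have "T * (unit_ball_vol ?n * r ^ ?n) + T powr (1 - \<gamma>) *
         (C * (2 powr (?n + \<beta>)) powr (q / p) * L powr (q / p) * r powr (q / p * d))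
         = unit_ball_vol ?n * (T * r ^ ?n) + C * (2 powr (?n + \<beta>)) powr (q / p) *
            (T powr (1 - \<gamma>) * (L powr (q / p) * r powr (q / p * d)))"
        by (simp add: mult_ac)
      then show ?thesis unfolding a b by (simp add: K1_def algebra_simps)
    qed
    also have "ennreal \<dots> \<le> ennreal (L * r powr (?n + \<beta>))"
      using L1 by (intro ennreal_leI mult_right_mono) auto
    finally show ?thesis .
  qed
  have dyadic: "?I z r \<le> ennreal (L * r powr (?n + \<beta>))"
    if "z \<in> A" "\<rho> / 2 ^ k < r" "r \<le> 2 * \<rho>" for z r k
    using that
  proof (induction k arbitrary: r)
    case 0
    have "?I z r \<le> ?I z (2 * \<rho>)"
      using 0 by (intro nn_integral_mono mult_left_mono indicator_leI) auto
    also have "\<dots> \<le> ennreal W" by (rule W[OF 0(1)])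
    also have "\<dots> \<le> ennreal (L * r powr (?n + \<beta>))"
    proof (rule ennreal_leI)
      have "W \<le> L * \<rho> powr (?n + \<beta>)" using L(2) \<rho> by (simp add: divide_le_eq)
      also have "\<dots> \<le> L * r powr (?n + \<beta>)"
        using 0 \<rho> n\<beta> L0 by (intro mult_left_mono powr_mono2) auto
      finally show "W \<le> L * r powr (?n + \<beta>)" .
    qed
    finally show ?case .
  next
    case (Suc k)
    show ?case
    proof (cases "\<rho> < r")
      case True
      have "\<rho> * 1 \<le> \<rho> * 2 ^ k" using \<rho> by (intro mult_left_mono) auto
      with True have "\<rho> / 2 ^ k < r" by (smt (verit) divide_le_eq zero_less_power)
      with Suc show ?thesis by blast
    next
      case False
      have "r > 0" using Suc.prems(2) \<rho> by (smt (verit) divide_pos_pos zero_less_power)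
      moreover have "?I z (2 * r) \<le> ennreal (L * (2 * r) powr (?n + \<beta>))"
        using Suc.prems False by (intro Suc.IH) (auto simp: field_simps)
      ultimately show ?thesis using step[OF Suc.prems(1)] False by simp
    qed
  qed
  define K where "K = C * (2 powr (?n + \<beta>)) powr (q / p) * L powr (q / p)"
  have "K > 0" using C L0 by (simp add: K_def)
  moreover have "?J z r \<le> ennreal (K * r powr (q / p * d))" if "z \<in> A" "0 < r" "r \<le> \<rho>" for z r
  proof -
    obtain k where "\<rho> / (2 * r) < 2 ^ k" using real_arch_pow[of 2 "\<rho> / (2 * r)"] by auto
    then have "\<rho> / 2 ^ k < 2 * r" using that by (simp add: field_simps)
    with that dyadic J show ?thesis unfolding K_def by (meson mult_left_mono zero_le_numeral)
  qed
  ultimately show ?thesis by blast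
qed

section \<open>Packing numbers of porous sets\<close>

text \<open>By porosity, a point \<open>z\<close> of \<open>X j\<close> has a ball in its vicinity whose radius and whose distance to the complement of \<open>G\<close> are
  comparable to the scale \<open>r * (c / 3) ^ j\<close>. Balls of equal scale are disjoint by separation. Balls of
  different scales are disjoint because the ratio \<open>c / 3\<close> of consecutive scales is small enough to make the ranges of the
  distance to the complement disjoint. Hence the integral over \<open>ball x (2 * r)\<close> dominates the sum over all scales at
  once, which is what later gives a strict improvement of the exponent.\<close>

lemma porous_packing_sum:
  fixes A G :: "'a::euclidean_space set" and e s c K r :: real
  assumes G: "open G" and A: "A \<subseteq> - G" and c: "0 < c" "c < 1" and K: "0 < K" and r: "0 < r"
    and e: "e \<le> 0" and s: "s = real DIM('a) + e"
    and int: "(\<integral>\<^sup>+y\<in>ball x (2 * r) \<inter> G. ennreal (infdist y (- G) powr e) \<partial>lborel) \<le> ennreal (K * (2 * r) powr s)"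
    and porous: "\<And>z \<rho>. z \<in> A \<Longrightarrow> 0 < \<rho> \<Longrightarrow> \<rho> < r \<Longrightarrow> \<exists>y. ball y (c * \<rho>) \<subseteq> ball z \<rho> \<inter> G"
    and X: "\<And>j. j \<le> k \<Longrightarrow> finite (X j) \<and> X j \<subseteq> A \<inter> ball x r \<and> separated (r * (c / 3) ^ j) (X j)"
  shows "(\<Sum>j\<le>k. real (card (X j)) * ((c / 3) powr s) ^ j)
     \<le> K * 4 powr s / (unit_ball_vol DIM('a) * (c / 2) ^ DIM('a))"
proof -
  let ?n = "DIM('a)" and ?d = "\<lambda>y. infdist y (- G)"
  define a where "a = c / 3"
  have a: "0 < a" "a < 1" using c by (auto simp: a_def)
  define \<rho> where "\<rho> j = r * a ^ j / 2" for j :: nat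
  have \<rho>: "0 < \<rho> j" "\<rho> j < r" for j
  proof -
    show "0 < \<rho> j" using r a by (simp add: \<rho>_def)
    have "a ^ j \<le> 1" using a by (simp add: power_le_one)
    then have "r * a ^ j \<le> r * 1" using r by (intro mult_left_mono) auto
    then show "\<rho> j < r" using r by (simp add: \<rho>_def)
  qed
  define I where "I = Sigma {..k} X"
  have fin: "finite I" using X by (auto simp: I_def)
  have "\<forall>i\<in>I. \<exists>y. ball y (c * \<rho> (fst i)) \<subseteq> ball (snd i) (\<rho> (fst i)) \<inter> G"
    using X porous \<rho> by (fastforce simp: I_def)
  then obtain y where y: "\<And>i. i \<in> I \<Longrightarrow> ball (y i) (c * \<rho> (fst i)) \<subseteq> ball (snd i) (\<rho> (fst i)) \<inter> G"
    by metis
  define D where "D i = ball (y i) (c * \<rho> (fst i) / 2)" for i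
  have [measurable]: "D i \<in> sets borel" for i by (simp add: D_def)
  have [measurable]: "G \<in> sets borel" using G by (rule borel_open)
  have [measurable]: "?d \<in> borel_measurable borel"
    by (intro borel_measurable_continuous_onI continuous_intros)
  have low: "c * \<rho> (fst i) / 2 \<le> ?d w" and up: "?d w < \<rho> (fst i)"
    and near: "dist (snd i) w < \<rho> (fst i)" and inG: "w \<in> G" if i: "i \<in> I" "w \<in> D i" for i w
  proof -
    have c\<rho>: "c * \<rho> (fst i) > 0" using c \<rho> by simp
    have w: "w \<in> ball (y i) (c * \<rho> (fst i))" using i(2) c\<rho> by (simp add: D_def)
    then show "w \<in> G" and n: "dist (snd i) w < \<rho> (fst i)" using y[OF i(1)] by auto
    have "snd i \<in> - G" using i(1) X A by (fastforce simp: I_def)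
    then show "?d w < \<rho> (fst i)"
      using n infdist_le[of "snd i" "- G" w] by (simp add: dist_commute)
    have "c * \<rho> (fst i) / 2 \<le> dist w g" if "g \<in> - G" for g
    proof -
      have "g \<notin> ball (y i) (c * \<rho> (fst i))" using y[OF i(1)] that by blast
      with i(2) dist_triangle[of "y i" g w] show ?thesis by (simp add: D_def)
    qed
    with \<open>snd i \<in> - G\<close> show "c * \<rho> (fst i) / 2 \<le> ?d w"
      by (intro le_infdistI) auto
  qed
  have disj: "disjoint_family_on D I"
    unfolding disjoint_family_on_def
  proof (intro ballI impI equals0I)
    fix i i' w assume i: "i \<in> I" "i' \<in> I" "i \<noteq> i'" and w: "w \<in> D i \<inter> D i'"
    have scales: "\<not> j < j'" if "i1 \<in> I" "i2 \<in> I" "fst i1 = j" "fst i2 = j'" "w \<in> D i1" "w \<in> D i2" for i1 i2 j j'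
    proof
      assume "j < j'"
      then have "a ^ j' \<le> a ^ Suc j" using a by (intro power_decreasing) auto
      then have "\<rho> j' \<le> a * \<rho> j" using r by (simp add: \<rho>_def)
      also have "\<dots> < c * \<rho> j / 2" using \<rho>[of j] c by (simp add: a_def)
      finally show False using low[of i1 w] up[of i2 w] that by auto
    qed
    have eq: "fst i = fst i'" using scales[of i i'] scales[of i' i] i w by fastforce
    then have "snd i \<noteq> snd i'" using i(3) by (simp add: prod_eq_iff)
    then have "r * a ^ fst i \<le> dist (snd i) (snd i')"
      using X[of "fst i"] i eq by (auto simp: I_def separated_def a_def)
    moreover have "dist (snd i) (snd i') < \<rho> (fst i) + \<rho> (fst i)"
      using near[of i w] near[of i' w] i w eq dist_triangle2[of "snd i" "snd i'" w] by simp
    ultimately show False by (simp add: \<rho>_def)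
  qed
  define V where "V = unit_ball_vol ?n * (c / 2) ^ ?n * (r / 2) powr s"
  have V: "V > 0" using c r by (simp add: V_def)
  have lower: "ennreal (V * (a powr s) ^ fst i) \<le> (\<integral>\<^sup>+w\<in>D i. ennreal (?d w powr e) \<partial>lborel)"
    if i: "i \<in> I" for i
  proof -
    let ?\<rho> = "\<rho> (fst i)"
    have pw: "(a powr s) ^ j = (a ^ j) powr s" for j
      using a by (simp add: powr_realpow[symmetric] powr_powr mult.commute)
    have "?\<rho> powr e * ?\<rho> ^ ?n = ?\<rho> powr s"
      using \<rho>[of "fst i"] by (simp add: s powr_add powr_realpow)
    also have "?\<rho> powr s = (r / 2) powr s * (a powr s) ^ fst i"
      using a r by (simp add: pw \<rho>_def flip: powr_mult)
    finally have "V * (a powr s) ^ fst i = ?\<rho> powr e * (unit_ball_vol ?n * (c * ?\<rho> / 2) ^ ?n)"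
      by (simp add: V_def power_mult_distrib power_divide mult_ac)
    then have "ennreal (V * (a powr s) ^ fst i) = ennreal (?\<rho> powr e) * emeasure lborel (D i)"
      using \<rho>[of "fst i"] c by (simp add: D_def emeasure_ball ennreal_mult)
    also have "\<dots> = (\<integral>\<^sup>+w. ennreal (?\<rho> powr e) * indicator (D i) w \<partial>lborel)"
      by (rule nn_integral_cmult_indicator[symmetric]) (simp add: D_def)
    also have "\<dots> \<le> (\<integral>\<^sup>+w\<in>D i. ennreal (?d w powr e) \<partial>lborel)"
    proof (rule nn_integral_mono)
      fix w
      show "ennreal (?\<rho> powr e) * indicator (D i) w \<le> ennreal (?d w powr e) * indicator (D i) w"
      proof (cases "w \<in> D i")
        case True
        have "0 < c * ?\<rho> / 2" using c \<rho> by simp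
        then have "?\<rho> powr e \<le> ?d w powr e"
          using low[OF i True] up[OF i True] e by (intro powr_mono2') auto
        then show ?thesis by (intro mult_right_mono ennreal_leI) auto
      qed simp
    qed
    finally show ?thesis .
  qed
  have "ennreal (V * (\<Sum>j\<le>k. real (card (X j)) * (a powr s) ^ j)) = ennreal (\<Sum>i\<in>I. V * (a powr s) ^ fst i)"
  proof -
    have "(\<Sum>i\<in>I. V * (a powr s) ^ fst i) = (\<Sum>j\<le>k. \<Sum>z\<in>X j. V * (a powr s) ^ j)"
      unfolding I_def using X by (subst sum.Sigma) (auto simp: case_prod_beta)
    then show ?thesis by (simp add: sum_distrib_left mult_ac)
  qed
  also have "\<dots> = (\<Sum>i\<in>I. ennreal (V * (a powr s) ^ fst i))"
    using V by (intro sum_ennreal[symmetric]) simp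
  also have "\<dots> \<le> (\<Sum>i\<in>I. \<integral>\<^sup>+w\<in>D i. ennreal (?d w powr e) \<partial>lborel)"
    by (intro sum_mono lower)
  also have "\<dots> = (\<integral>\<^sup>+w. (\<Sum>i\<in>I. ennreal (?d w powr e) * indicator (D i) w) \<partial>lborel)"
    by (rule nn_integral_sum[symmetric]) measurable
  also have "\<dots> \<le> (\<integral>\<^sup>+w\<in>ball x (2 * r) \<inter> G. ennreal (?d w powr e) \<partial>lborel)"
  proof (rule nn_integral_mono)
    fix w
    have "(\<Sum>i\<in>I. ennreal (?d w powr e) * indicator (D i) w) = ennreal (?d w powr e) * indicator (\<Union>i\<in>I. D i) w"
      by (simp add: indicator_UN_disjoint[OF fin disj] sum_distrib_left)
    also have "\<dots> \<le> ennreal (?d w powr e) * indicator (ball x (2 * r) \<inter> G) w"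
    proof (intro mult_left_mono indicator_leI)
      assume "w \<in> (\<Union>i\<in>I. D i)"
      then obtain i where i: "i \<in> I" "w \<in> D i" by blast
      have "snd i \<in> ball x r" using i(1) X by (fastforce simp: I_def)
      moreover have "dist (snd i) w < r" using near[OF i] \<rho>[of "fst i"] by simp
      ultimately have "w \<in> ball x (2 * r)" using dist_triangle[of x w "snd i"] by simp
      with inG[OF i] show "w \<in> ball x (2 * r) \<inter> G" by simp
    qed simp
    finally show "(\<Sum>i\<in>I. ennreal (?d w powr e) * indicator (D i) w)
      \<le> ennreal (?d w powr e) * indicator (ball x (2 * r) \<inter> G) w" .
  qed
  also have "\<dots> \<le> ennreal (K * (2 * r) powr s)" by (rule int)
  finally have "V * (\<Sum>j\<le>k. real (card (X j)) * (a powr s) ^ j) \<le> K * (2 * r) powr s"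
    using K by (simp add: ennreal_le_iff)
  also have "(2 * r) powr s = 4 powr s * (r / 2) powr s"
    using r by (simp flip: powr_mult)
  finally have "(unit_ball_vol ?n * (c / 2) ^ ?n) * (\<Sum>j\<le>k. real (card (X j)) * (a powr s) ^ j) * (r / 2) powr s
     \<le> K * 4 powr s * (r / 2) powr s"
    by (simp add: V_def mult_ac)
  then have "(unit_ball_vol ?n * (c / 2) ^ ?n) * (\<Sum>j\<le>k. real (card (X j)) * (a powr s) ^ j) \<le> K * 4 powr s"
    using r by simp
  moreover have "unit_ball_vol ?n * (c / 2) ^ ?n > 0" using c by simp
  ultimately show ?thesis
    unfolding a_def by (simp add: pos_le_divide_eq mult.commute)
qed

lemma card_le_of_net:
  assumes "finite X" "finite Y" "X \<subseteq> (\<Union>z\<in>Y. ball z t)"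
    and "real (card Y) \<le> u" "\<And>z. z \<in> Y \<Longrightarrow> real (card (X \<inter> ball z t)) \<le> v" "0 \<le> v"
  shows "real (card X) \<le> u * v"
proof -
  have "X = (\<Union>z\<in>Y. X \<inter> ball z t)" using assms(3) by auto
  then have "real (card X) \<le> (\<Sum>z\<in>Y. real (card (X \<inter> ball z t)))"
    using card_UN_le[OF assms(2), of "\<lambda>z. X \<inter> ball z t"] by (metis of_nat_mono of_nat_sum)
  also have "\<dots> \<le> (\<Sum>z\<in>Y. v)" by (intro sum_mono assms(5))
  also have "\<dots> \<le> u * v" using assms(4,6) by (simp add: mult_right_mono)
  finally show ?thesis .
qed

text \<open>Write \<open>u = a powr s\<close>. The hypothesis alone bounds \<open>card Z * u ^ k\<close> by \<open>C0\<close> for separated sets \<open>Z\<close> at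
  relative scale \<open>a ^ k\<close>, which is the exponent \<open>s\<close>. To gain, pass from relative scale \<open>1\<close> to \<open>a ^ j\<close> with a net
  \<open>Y j\<close> and from there to \<open>a ^ k\<close> with the bound \<open>C0\<close>: this gives \<open>card Z * u ^ k \<le> C0 * (card (Y j) * u ^ j)\<close> for every
  \<open>j \<le> k\<close>. Summing over \<open>j\<close> and using the summability hypothesis on the nets yields
  \<open>card Z * u ^ k \<le> C0\<^sup>2 / (k + 1)\<close>. So for one fixed \<open>K\<close> the bound is \<open>1 / 2\<close>, and iterating it over blocks of
  \<open>K\<close> generations gives geometric decay, that is, an exponent below \<open>s\<close>.\<close>

lemma packing_exponent_improvement:
  fixes A :: "'a::euclidean_space set" and D a s C0 :: real
  assumes "bounded A" and a: "0 < a" "a < 1" and s: "0 < s" and C0: "0 < C0"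
    and sum: "\<And>x r k X. \<lbrakk>x \<in> A; 0 < r; r < D;
       \<And>j. j \<le> k \<Longrightarrow> finite (X j) \<and> X j \<subseteq> A \<inter> ball x r \<and> separated (r * a ^ j) (X j)\<rbrakk> \<Longrightarrow>
       (\<Sum>j\<le>k. real (card (X j)) * (a powr s) ^ j) \<le> C0"
  shows "\<exists>l C. 0 \<le> l \<and> l < s \<and> C > 0 \<and> (\<forall>x\<in>A. \<forall>r R. 0 < r \<and> r < R \<and> R < D \<longrightarrow>
      real (covering_number (A \<inter> ball x R) r) \<le> C * (r / R) powr (- l))"
proof -
  define u where "u = a powr s"
  have u: "u > 0" using a by (simp add: u_def)
  have net: "\<exists>Y. finite Y \<and> Y \<subseteq> A \<inter> ball x r \<and> separated t Y \<and> A \<inter> ball x r \<subseteq> (\<Union>z\<in>Y. ball z t)"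
    if "t > 0" for x r t
    using exists_maximal_separated[of "A \<inter> ball x r" t] assms(1) that by (metis bounded_Int)
  have single: "real (card Y) \<le> C0 / u ^ j"
    if "x \<in> A" "0 < r" "r < D" "finite Y" "Y \<subseteq> A \<inter> ball x r" "separated (r * a ^ j) Y" for x r j Y
  proof -
    define X where "X i = (if i = j then Y else {})" for i :: nat
    have "(\<Sum>i\<le>j. real (card (X i)) * u ^ i) \<le> C0"
      unfolding u_def using that by (intro sum) (auto simp: X_def separated_def)
    moreover have "(\<Sum>i\<le>j. real (card (X i)) * u ^ i) = (\<Sum>i\<le>j. if i = j then real (card Y) * u ^ j else 0)"
      by (intro sum.cong) (auto simp: X_def)
    ultimately have "real (card Y) * u ^ j \<le> C0" by simp
    then show ?thesis using u by (simp add: pos_le_divide_eq)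
  qed
  have decay: "real (Suc k) * (real (card Z) * u ^ k) \<le> C0 * C0"
    if x: "x \<in> A" "0 < r" "r < D" and Z: "finite Z" "Z \<subseteq> A \<inter> ball x r" "separated (r * a ^ k) Z" for x r k Z
  proof -
    have "\<forall>j. \<exists>Y. finite Y \<and> Y \<subseteq> A \<inter> ball x r \<and> separated (r * a ^ j) Y \<and> A \<inter> ball x r \<subseteq> (\<Union>z\<in>Y. ball z (r * a ^ j))"
      using net x(2) a by simp
    then obtain Y where Y: "\<And>j. finite (Y j) \<and> Y j \<subseteq> A \<inter> ball x r \<and> separated (r * a ^ j) (Y j) \<and>
        A \<inter> ball x r \<subseteq> (\<Union>z\<in>Y j. ball z (r * a ^ j))" by metis
    have "real (card Z) * u ^ k \<le> C0 * (real (card (Y j)) * u ^ j)" if j: "j \<le> k" for j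
    proof -
      have "a ^ j \<le> 1" using a by (simp add: power_le_one)
      then have "r * a ^ j \<le> r * 1" using x by (intro mult_left_mono) auto
      then have rj: "0 < r * a ^ j" "r * a ^ j < D" using x a by (simp, linarith)
      have "real (card Z) \<le> real (card (Y j)) * (C0 / u ^ (k - j))"
      proof (rule card_le_of_net)
        show "Z \<subseteq> (\<Union>z\<in>Y j. ball z (r * a ^ j))" using Y[of j] Z(2) by blast
        show "real (card (Z \<inter> ball z (r * a ^ j))) \<le> C0 / u ^ (k - j)" if "z \<in> Y j" for z
        proof (rule single[of z "r * a ^ j"])
          show "separated (r * a ^ j * a ^ (k - j)) (Z \<inter> ball z (r * a ^ j))"
            using Z(3) j by (auto simp: mult.assoc simp flip: power_add intro: separated_subset)
        qed (use that Y[of j] Z rj in auto)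
      qed (use Z Y[of j] C0 u in auto)
      then have "real (card Z) * u ^ k \<le> real (card (Y j)) * (C0 / u ^ (k - j)) * u ^ k"
        using u by (intro mult_right_mono) auto
      also have "\<dots> = real (card (Y j)) * (C0 / u ^ (k - j)) * (u ^ (k - j) * u ^ j)"
        using j by (simp flip: power_add)
      also have "\<dots> = C0 * (real (card (Y j)) * u ^ j)" using u by simp
      finally show ?thesis .
    qed
    then have "(\<Sum>j\<le>k. real (card Z) * u ^ k) \<le> (\<Sum>j\<le>k. C0 * (real (card (Y j)) * u ^ j))"
      by (intro sum_mono) auto
    also have "\<dots> = C0 * (\<Sum>j\<le>k. real (card (Y j)) * u ^ j)" by (simp add: sum_distrib_left)
    also have "\<dots> \<le> C0 * C0"
      unfolding u_def using C0 x Y by (intro mult_left_mono sum) auto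
    finally show ?thesis by simp
  qed
  obtain k where k: "2 * (C0 * C0) < real k" using reals_Archimedean2 by blast
  define K where "K = Suc k"
  define v where "v = 1 / (2 * u ^ K)"
  have v: "v > 0" using u by (simp add: v_def)
  have half: "real (card Z) \<le> v"
    if x: "x \<in> A" "0 < r" "r < D" and Z: "finite Z" "Z \<subseteq> A \<inter> ball x r" "separated (r * a ^ K) Z" for x r Z
  proof -
    have "real (Suc K) * (real (card Z) * u ^ K) \<le> C0 * C0" by (rule decay[OF that])
    also have "\<dots> \<le> real (Suc K) * (1 / 2)" using k by (simp add: K_def)
    finally have "real (card Z) * u ^ K \<le> 1 / 2" by (simp del: of_nat_Suc)
    then show ?thesis using u by (simp add: v_def field_simps)
  qed
  define h where "h = a ^ K"
  have "a ^ K < 1 ^ K" using a by (intro power_strict_mono) (auto simp: K_def)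
  then have h: "0 < h" "h < 1" using a by (auto simp: h_def)
  have iter: "real (card Z) \<le> C0 * v ^ m"
    if "x \<in> A" "0 < r" "r < D" "finite Z" "Z \<subseteq> A \<inter> ball x r" "separated (r * h ^ m) Z" for x r m Z
    using that
  proof (induction m arbitrary: x r Z)
    case 0
    then show ?case using single[of x r Z 0] by simp
  next
    case (Suc m)
    have "r * h < r * 1" using h Suc.prems by (intro mult_strict_left_mono) auto
    then have rh: "0 < r * h" "r * h < D" using h Suc.prems(2,3) by (simp, linarith)
    obtain Y where Y: "finite Y" "Y \<subseteq> A \<inter> ball x r" "separated (r * h) Y" "A \<inter> ball x r \<subseteq> (\<Union>z\<in>Y. ball z (r * h))"
      using net rh(1) by metis
    have "real (card Z) \<le> v * (C0 * v ^ m)"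
    proof (rule card_le_of_net[OF Suc.prems(4) Y(1)])
      show "Z \<subseteq> (\<Union>z\<in>Y. ball z (r * h))" using Suc.prems Y by blast
      show "real (card Y) \<le> v" using half[of x r Y] Suc.prems Y by (simp add: h_def)
      show "real (card (Z \<inter> ball z (r * h))) \<le> C0 * v ^ m" if "z \<in> Y" for z
        using Suc.prems Y that rh
        by (intro Suc.IH[of z "r * h"]) (auto simp: mult_ac intro: separated_subset)
    qed (use C0 v in simp)
    then show ?case by (simp add: mult_ac)
  qed
  \<comment> \<open>The exponent for which one block of \<open>K\<close> generations, of ratio \<open>h\<close>, multiplies cardinalities by \<open>v\<close>.\<close>
  define l' where "l' = - ln v / ln h"
  have "ln h < 0" using h by simp
  have hl': "h powr (- l') = v"
    using h v \<open>ln h < 0\<close> by (simp add: powr_def l'_def)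
  have l's: "l' < s"
  proof -
    have "h powr s = u ^ K"
      using a by (simp add: h_def u_def powr_realpow[symmetric] powr_powr mult.commute)
    then have "v * h powr s < 1" using u by (simp add: v_def)
    moreover have "h powr (s - l') = h powr s * h powr (- l')" by (simp flip: powr_add)
    ultimately have "h powr (s - l') < 1" by (simp add: hl' mult.commute)
    then show ?thesis
      using powr_mono'[of "s - l'" 0 h] h by (cases "l' < s") auto
  qed
  \<comment> \<open>When there is no admissible centre or radius, \<open>v\<close> may be below \<open>1\<close> and \<open>l'\<close> negative.\<close>
  define l where "l = max 0 l'"
  have l: "0 \<le> l" "l < s" "l' \<le> l" using l's s by (auto simp: l_def)
  have vl: "v \<le> h powr (- l)"
    unfolding hl'[symmetric] using l h by (intro powr_mono') auto
  define C where "C = C0 * h powr (- l)"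
  have "C > 0" using C0 h by (simp add: C_def)
  moreover have "real (covering_number (A \<inter> ball x R) r) \<le> C * (r / R) powr (- l)"
    if x: "x \<in> A" and r: "0 < r" "r < R" and R: "R < D" for x r R
  proof -
    define \<eta> where "\<eta> = r / R"
    have \<eta>: "0 < \<eta>" "\<eta> < 1" using r by (auto simp: \<eta>_def)
    obtain N where N: "h ^ N < \<eta>" using real_arch_pow_inv[OF \<eta>(1) h(2)] by blast
    define N0 where "N0 = (LEAST N. h ^ N \<le> \<eta>)"
    have N0: "h ^ N0 \<le> \<eta>" unfolding N0_def by (rule LeastI[of _ N]) (use N in simp)
    then have "N0 \<noteq> 0" using \<eta> by (intro notI) simp
    then obtain m where m: "N0 = Suc m" using not0_implies_Suc by blast
    have "\<not> h ^ m \<le> \<eta>" using not_less_Least[of m "\<lambda>N. h ^ N \<le> \<eta>"] m by (simp add: N0_def)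
    then have hm: "\<eta> \<le> h ^ m" by simp
    obtain Y where Y: "finite Y" "Y \<subseteq> A \<inter> ball x R" "separated r Y" "A \<inter> ball x R \<subseteq> (\<Union>z\<in>Y. ball z r)"
      using net r(1) by metis
    have "R * h ^ Suc m \<le> r" using N0 r by (simp add: m \<eta>_def field_simps)
    with Y(3) have "separated (R * h ^ Suc m) Y" by (rule separated_mono)
    then have "real (card Y) \<le> C0 * v ^ Suc m"
      using x r R Y by (intro iter[of x R]) auto
    also have "\<dots> \<le> C0 * (h powr (- l) * \<eta> powr (- l))"
    proof -
      have "v ^ m \<le> (h powr (- l)) ^ m" using vl v by (intro power_mono) auto
      also have "\<dots> = (h ^ m) powr (- l)"
        using h by (simp add: powr_realpow[symmetric] powr_powr mult.commute)
      also have "\<dots> \<le> \<eta> powr (- l)" using hm \<eta> l by (intro powr_mono2') auto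
      finally have "v * v ^ m \<le> h powr (- l) * \<eta> powr (- l)"
        using vl v by (intro mult_mono) auto
      then show ?thesis using C0 by simp
    qed
    finally have "real (card Y) \<le> C * (r / R) powr (- l)" by (simp add: C_def \<eta>_def)
    moreover have "covering_number (A \<inter> ball x R) r \<le> card Y"
      by (rule covering_number_le[OF Y(1,2,4)])
    ultimately show ?thesis by linarith
  qed
  ultimately show ?thesis using l by blast
qed

section \<open>The dimension dichotomy\<close>

theorem proposition8p2:
  fixes G :: "'a::euclidean_space set" and p q \<beta> lam :: real
  assumes "DIM('a) \<ge> 2"
    and "open G" and "G \<noteq> {}" and "frontier G \<noteq> {}"
    and "1 \<le> p" and "p < q" and "p < real DIM('a)"
    and "q < real DIM('a) * p / (real DIM('a) - p)"
    and "\<beta> < 0"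
    and "hardy_sobolev q p \<beta> G"
    and "lam = 8 * sqrt (real DIM('a))"
  shows "\<forall>x R. R > 0 \<and>
      (\<integral>\<^sup>+y\<in>cball x (lam * R). dist_power (- G) \<beta> y \<partial>lborel) < \<infinity> \<and>
      porous (- G \<inter> cball x (lam * R)) \<longrightarrow>
    upper_assouad_dim (- G \<inter> cball x R) < q / p * (real DIM('a) - p + \<beta>) \<or>
    lower_minkowski_dim (- G \<inter> cball x (lam * R)) \<ge> real DIM('a) - p + \<beta>"
proof (intro allI impI, elim conjE)
  fix x :: 'a and R :: real
  assume R: "R > 0" and fin: "(\<integral>\<^sup>+y\<in>cball x (lam * R). dist_power (- G) \<beta> y \<partial>lborel) < \<infinity>"
    and por: "porous (- G \<inter> cball x (lam * R))"
  let ?n = "real DIM('a)" and ?E = "- G \<inter> cball x (lam * R)" and ?A = "- G \<inter> cball x R"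
  let ?\<delta> = "\<lambda>y. infdist y (- G)"
  define d where "d = ?n - p + \<beta>"
  define e where "e = q / p * d - ?n"
  have "upper_assouad_dim ?A < q / p * d" if mink: "lower_minkowski_dim ?E < d"
  proof -
    have "10 < lam"
    proof -
      have "5 / 4 < sqrt (2::real)" by (rule real_less_rsqrt) (simp add: power2_eq_square)
      also have "sqrt 2 \<le> sqrt ?n" using assms(1) by simp
      finally show ?thesis using assms(11) by simp
    qed
    \<comment> \<open>Scales up to the diameter \<open>2 * R\<close> are needed, the integral is taken over the doubled ball, the local inequality doubles
      it again, and centres lie within \<open>R\<close>: everything happens inside the ball of radius \<open>9 * R\<close>.\<close>
    then have TR: "10 * R < lam * R" using R by simp
    obtain l where l: "0 \<le> l" "l < d"
      "\<And>\<epsilon>. \<epsilon> > 0 \<Longrightarrow> \<exists>r. 0 < r \<and> r < \<epsilon> \<and> real (covering_number ?E r) * r powr l < \<epsilon>"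
      using exists_minkowski_exponent[OF _ mink] by (auto simp: bounded_Int)
    have d: "0 < d" using l by simp
    have pq: "0 < p" "0 < q" "1 < q / p" using assms(5,6) by (auto simp: field_simps)
    \<comment> \<open>The subcriticality of \<open>q\<close> enters here.\<close>
    have "q / p * (?n - p) < ?n" using assms(5,7,8) by (simp add: field_simps)
    then have e1: "e < q / p * \<beta>" by (simp add: e_def d_def algebra_simps)
    have "q / p * \<beta> < 1 * \<beta>" using pq assms(9) by (intro mult_strict_right_mono_neg) auto
    with e1 have e2: "e < \<beta>" by simp
    have "G \<noteq> UNIV" using assms(4) by auto
    then have "closed (- G)" "- G \<noteq> {}" using assms(2) by auto
    have pos: "0 < ?\<delta> y" if "y \<in> G" for y
      using in_closed_iff_infdist_zero[OF \<open>closed (- G)\<close> \<open>- G \<noteq> {}\<close>, of y] that infdist_nonneg[of y "- G"]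
      by (auto simp: less_le)
    have "\<exists>C>0. \<forall>z r w. r > 0 \<and> w > 0 \<and> dist x z + 2 * r < lam * R \<and>
       (\<integral>\<^sup>+y\<in>ball z (2 * r) \<inter> G. ennreal (?\<delta> y powr \<beta>) \<partial>lborel) \<le> ennreal w \<longrightarrow>
     (\<integral>\<^sup>+y\<in>ball z r \<inter> G. ennreal (?\<delta> y powr e) \<partial>lborel)
       \<le> ennreal (C * (r powr (- p) * w) powr (q / p))"
      unfolding e_def d_def
      by (rule hardy_sobolev_local[where l = l])
         (use assms(2,4,5,9,10) pq l e2 in \<open>simp_all add: e_def d_def\<close>)
    then obtain C where C: "C > 0" and local: "\<forall>z r w. r > 0 \<and> w > 0 \<and> dist x z + 2 * r < lam * R \<and>
       (\<integral>\<^sup>+y\<in>ball z (2 * r) \<inter> G. ennreal (?\<delta> y powr \<beta>) \<partial>lborel) \<le> ennreal w \<longrightarrow>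
     (\<integral>\<^sup>+y\<in>ball z r \<inter> G. ennreal (?\<delta> y powr e) \<partial>lborel)
       \<le> ennreal (C * (r powr (- p) * w) powr (q / p))"
      by (elim exE conjE)
    define W where "W = enn2real (\<integral>\<^sup>+y\<in>cball x (lam * R). dist_power (- G) \<beta> y \<partial>lborel)"
    have base: "(\<integral>\<^sup>+y\<in>ball z (2 * (4 * R)) \<inter> G. ennreal (?\<delta> y powr \<beta>) \<partial>lborel) \<le> ennreal W"
      if z: "z \<in> ?A" for z
    proof -
      have "(\<integral>\<^sup>+y\<in>ball z (2 * (4 * R)) \<inter> G. ennreal (?\<delta> y powr \<beta>) \<partial>lborel)
          \<le> (\<integral>\<^sup>+y\<in>cball x (lam * R). dist_power (- G) \<beta> y \<partial>lborel)"
      proof (rule nn_integral_mono)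
        fix y
        show "ennreal (?\<delta> y powr \<beta>) * indicator (ball z (2 * (4 * R)) \<inter> G) y
          \<le> dist_power (- G) \<beta> y * indicator (cball x (lam * R)) y"
        proof (cases "y \<in> ball z (2 * (4 * R)) \<inter> G")
          case True
          then have "dist z y < 8 * R" "dist x z \<le> R" using z by auto
          then have "dist x y \<le> lam * R" using TR R dist_triangle[of x y z] by linarith
          then have "y \<in> cball x (lam * R)" by simp
          moreover have "y \<notin> closure (- G)" using True \<open>closed (- G)\<close> by simp
          ultimately show ?thesis by (simp add: dist_power_def indicator_def)
        qed simp
      qed
      then show ?thesis using fin by (simp add: W_def)
    qed
    have "\<exists>K>0. \<forall>z\<in>?A. \<forall>r. 0 < r \<and> r \<le> 4 * R \<longrightarrow>
       (\<integral>\<^sup>+y\<in>ball z r \<inter> G. ennreal (?\<delta> y powr e) \<partial>lborel) \<le> ennreal (K * r powr (q / p * d))"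
    proof (rule integral_growth_bootstrap[where A = ?A and G = G and \<delta> = ?\<delta> and p = p and q = q
            and \<beta> = \<beta> and \<rho> = "4 * R" and W = W and C = C, folded d_def, folded e_def])
      show "?\<delta> \<in> borel_measurable borel"
        by (intro borel_measurable_continuous_onI continuous_intros)
      show "G \<in> sets borel" using assms(2) by (rule borel_open)
      show "(\<integral>\<^sup>+y\<in>ball z r \<inter> G. ennreal (?\<delta> y powr e) \<partial>lborel)
            \<le> ennreal (C * (r powr (- p) * w) powr (q / p))"
        if z: "z \<in> ?A" and r: "0 < r" "r \<le> 4 * R" and w: "0 < w"
          "(\<integral>\<^sup>+y\<in>ball z (2 * r) \<inter> G. ennreal (?\<delta> y powr \<beta>) \<partial>lborel) \<le> ennreal w" for z r w
      proof (rule local[rule_format], intro conjI)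
        have "dist x z \<le> R" using z by simp
        then show "dist x z + 2 * r < lam * R" using r TR R by linarith
      qed (rule r w)+
    qed (use pos pq assms(9) d e1 e2 R C base in auto)
    then obtain K where K: "K > 0" and growth: "\<forall>z\<in>?A. \<forall>r. 0 < r \<and> r \<le> 4 * R \<longrightarrow>
       (\<integral>\<^sup>+y\<in>ball z r \<inter> G. ennreal (?\<delta> y powr e) \<partial>lborel) \<le> ennreal (K * r powr (q / p * d))"
      by (elim exE conjE)
    define D where "D = diameter ?A"
    have "bounded ?A" by (simp add: bounded_Int)
    have DR: "D \<le> 2 * R"
    proof -
      have "D \<le> diameter (cball x R)" unfolding D_def by (intro diameter_subset) auto
      then show ?thesis using R by simp
    qed
    have DE: "D \<le> diameter ?E"
    proof -
      have "R \<le> lam * R" using TR R by linarith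
      then have "?A \<subseteq> ?E" by (intro Int_mono subset_cball order_refl)
      then show ?thesis unfolding D_def by (rule diameter_subset) (simp add: bounded_Int)
    qed
    obtain c where c: "0 < c" "c < 1" and por:
      "\<And>z r. \<lbrakk>z \<in> ?E; 0 < r; less_diameter r ?E\<rbrakk> \<Longrightarrow> \<exists>y. ball y (c * r) \<subseteq> ball z r - ?E"
      using por unfolding porous_def by blast
    have por': "\<exists>y. ball y (c * r) \<subseteq> ball z r \<inter> G" if z: "z \<in> ?A" and r: "0 < r" "r < D" for z r
    proof -
      have dz: "dist x z \<le> R" using z by simp
      then have "dist x z \<le> lam * R" using TR R by linarith
      then have "z \<in> ?E" using z by simp
      moreover have "less_diameter r ?E" using r DE by (simp add: less_diameter_def)
      ultimately obtain y where y: "ball y (c * r) \<subseteq> ball z r - ?E" using por r by blast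
      have "ball z r \<subseteq> cball x (lam * R)"
      proof
        fix w assume "w \<in> ball z r"
        then have "dist z w < r" by simp
        then have "dist x w \<le> lam * R"
          using dz TR R r DR dist_triangle[of x w z] by linarith
        then show "w \<in> cball x (lam * R)" by simp
      qed
      with y have "ball y (c * r) \<subseteq> ball z r \<inter> G" by auto
      then show ?thesis by blast
    qed
    define s where "s = q / p * d"
    have s: "s = ?n + e" "0 < s" using d pq by (auto simp: s_def e_def)
    define C0 where "C0 = K * 4 powr s / (unit_ball_vol DIM('a) * (c / 2) ^ DIM('a))"
    have C0: "C0 > 0" using K c by (simp add: C0_def)
    have "\<exists>l C. 0 \<le> l \<and> l < s \<and> C > 0 \<and> (\<forall>z\<in>?A. \<forall>r t. 0 < r \<and> r < t \<and> t < D \<longrightarrow>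
        real (covering_number (?A \<inter> ball z t) r) \<le> C * (r / t) powr (- l))"
    proof (rule packing_exponent_improvement[OF \<open>bounded ?A\<close>, of "c / 3" s C0 D])
      fix z r k X
      assume z: "z \<in> ?A" and r: "0 < r" "r < D" and X: "\<And>j. j \<le> k \<Longrightarrow>
          finite (X j) \<and> X j \<subseteq> ?A \<inter> ball z r \<and> separated (r * (c / 3) ^ j) (X j)"
      show "(\<Sum>j\<le>k. real (card (X j)) * ((c / 3) powr s) ^ j) \<le> C0"
        unfolding C0_def
      proof (rule porous_packing_sum[OF assms(2) _ c K r(1) _ s(1) _ _ X])
        show "(\<integral>\<^sup>+y\<in>ball z (2 * r) \<inter> G. ennreal (?\<delta> y powr e) \<partial>lborel) \<le> ennreal (K * (2 * r) powr s)"
          unfolding s_def by (rule growth[rule_format, OF z]) (use r DR in auto)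
        show "\<exists>y. ball y (c * \<rho>) \<subseteq> ball z \<rho> \<inter> G" if "z \<in> ?A" "0 < \<rho>" "\<rho> < r" for z \<rho>
          by (rule por') (use that r in auto)
      qed (use e2 assms(9) in auto)
    qed (use c s C0 in auto)
    then obtain l C1 where l': "0 \<le> l" "l < s" "C1 > 0"
      "\<forall>z\<in>?A. \<forall>r t. 0 < r \<and> r < t \<and> t < D \<longrightarrow>
        real (covering_number (?A \<inter> ball z t) r) \<le> C1 * (r / t) powr (- l)"
      by (elim exE conjE)
    have mem: "l \<in> {l. l \<ge> 0 \<and> (\<exists>C>0. \<forall>z\<in>?A. \<forall>r t. 0 < r \<and> r < t \<and> less_diameter t ?A \<longrightarrow>
        real (covering_number (?A \<inter> ball z t) r) \<le> C * (r / t) powr (- l))}"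
      using l' \<open>bounded ?A\<close> unfolding less_diameter_def D_def by blast
    have "upper_assouad_dim ?A \<le> l"
      unfolding upper_assouad_dim_def by (rule cInf_lower[OF mem]) (auto intro: bdd_belowI[of _ 0])
    then show ?thesis using l'(2) by (simp add: s_def)
  qed
  then show "upper_assouad_dim ?A < q / p * (?n - p + \<beta>) \<or> lower_minkowski_dim ?E \<ge> ?n - p + \<beta>"
    unfolding d_def by (meson not_le)
qed

end
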